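(* Let $E$ be a compact metric space with Borel $\sigma$-field $\mathcal{A}$, $T:E\to E$ continuous, $\mu$ a $T$-invariant Borel probability measure such that $S=(E,\mathcal{A},\mu,T)$ is uniquely ergodic, $f:E\to[0,1]$ continuous, $x\in E$, $\beta>0$, $J>0$. With $\mathbb{Q}_{n,x}$, $M_n$, $L$, $G$, types, strengths and the classes $\mathcal{C}_\alpha(S)$ as defined in the context, assume that $G$ has a unique global minimum point $m$, of type $2k$ and strength $\lambda$, and that for every $j\in\{1,\dots,2k\}$ the function $y\mapsto\frac{\partial^jL}{\partial s^j}(f(y),\beta Jm)$ belongs to $\mathcal{C}_{j/(2k)}(S)$. Then, under $\mathbb{Q}_{n,x}$, as $n\to\infty$, $$\frac{M_n-nm}{n^{1-1/(2k)}}\Rightarrow Z(2k,\tilde\lambda)$$ (convergence in distribution), where $Z(2k,\tilde\lambda)$ is the probability measure on $\mathbb{R}$ with density $C\exp\big(-\tilde\lambda s^{2k}/(2k)!\big)$, $C$ being a normalizing constant, and $$\tilde\lambda=\begin{cases}\left(\frac1\lambda-\frac1{\beta J}\right)^{-1}&\text{if }k=1,\\ \lambda&\text{if }k\ge2.\end{cases}$$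
   Context: Uniquely ergodic: $\mu$ is the only $T$-invariant Borel probability measure on $E$. Gibbs measure: for $n\ge1$, $\mathbb{Q}_{n,x}$ is the probability measure on $\{-1,+1\}^n$ giving $\sigma=(\sigma_1,\dots,\sigma_n)$ a mass proportional to $$\exp\Big(\frac{\beta J}{2n}\Big(\sum_{i=1}^n\sigma_i\Big)^2\Big)\prod_{i=1}^n p_i(\sigma_i),\qquad p_i(1)=f(T^ix),\ p_i(-1)=1-f(T^ix).$$ When $f$ takes values in $(0,1)$ this is the measure proportional to $\exp[H_{n,x}(\sigma)]$ with $H_{n,x}(\sigma)=\frac{\beta J}{2n}(\sum_i\sigma_i)^2+\frac12\sum_{i}\log\big(\frac{f(T^ix)}{1-f(T^ix)}\big)\sigma_i$. The magnetization is $M_n=\sum_{i=1}^n\sigma_i$. Functions: $L(\phi,s)=\log(\phi e^{s}+(1-\phi)e^{-s})$ on $[0,1]\times\mathbb{R}$; $\frac{\partial^j L}{\partial s^j}$ is the $j$-th partial derivative in the second variable; $G(s)=\frac{\beta J}{2}s^2-\int_EL(f(y),\beta Js)\,d\mu(y)$. Type and strength: for a global minimum point $m$ of $G$, the type is the (finite, even) integer $2k=\min\{j\ge1: G^{(j)}(m)\ne0\}$ and the strength is $\lambda=G^{(2k)}(m)>0$. Class $\mathcal{C}_\alpha(S)$, $\alpha\in[0,1]$: the $\mu$-integrable functions $h:E\to\mathbb{R}$ such that for every $y\in E$, $\big|\sum_{k=1}^n\big(h(T^ky)-\int_Eh\,d\mu\big)\big|=o(n^\alpha)$ as $n\to\i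nfty$.
   Formalization: In the degenerate case k=1, λ=βJ (e.g. f≡1), where (1/λ−1/(βJ))^{-1} is undefined, the parameter is read as ∞ and Z(2,∞) as the point mass at 0. *)

theory Defs
  imports "HOL-Probability.Probability" "HOL-Library.Landau_Symbols"
begin

text \<open>The space \<open>E\<close> is a compact subset of an ambient metric type; its Borel
  \<open>\<sigma>\<close>-field is that of \<open>restrict_space borel E\<close>.\<close>

definition invariant_prob :: "'a::metric_space set \<Rightarrow> ('a \<Rightarrow> 'a) \<Rightarrow> 'a measure \<Rightarrow> bool" where
  "invariant_prob E T \<nu> \<longleftrightarrow>
     prob_space \<nu> \<and> sets \<nu> = sets (restrict_space borel E) \<and>
     distr \<nu> (restrict_space borel E) T = \<nu>"

definition uniquely_ergodic :: "'a::metric_space set \<Rightarrow> ('a \<Rightarrow> 'a) \<Rightarrow> 'a measure \<Rightarrow> bool" where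
  "uniquely_ergodic E T \<mu> \<longleftrightarrow>
     invariant_prob E T \<mu> \<and> (\<forall>\<nu>. invariant_prob E T \<nu> \<longrightarrow> \<nu> = \<mu>)"

definition class_C ::
    "real \<Rightarrow> 'a set \<Rightarrow> ('a \<Rightarrow> 'a) \<Rightarrow> 'a measure \<Rightarrow> ('a \<Rightarrow> real) set" where
  "class_C \<alpha> E T \<mu> =
     {h. integrable \<mu> h \<and>
         (\<forall>y\<in>E. (\<lambda>n. \<bar>\<Sum>k=1..n. (h ((T ^^ k) y) - integral\<^sup>L \<mu> h)\<bar>)
                   \<in> o(\<lambda>n. real n powr \<alpha>))}"

definition configs :: "nat \<Rightarrow> (nat \<Rightarrow> real) set" where
  "configs n = (\<Pi>\<^sub>E i\<in>{1..n}. {-1, 1})"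

definition magnetization :: "nat \<Rightarrow> (nat \<Rightarrow> real) \<Rightarrow> real" where
  "magnetization n \<sigma> = (\<Sum>i=1..n. \<sigma> i)"

definition spin_prob :: "real \<Rightarrow> real \<Rightarrow> real" where
  "spin_prob p s = (if s = 1 then p else 1 - p)"

definition gibbs_weight ::
    "real \<Rightarrow> real \<Rightarrow> ('a \<Rightarrow> real) \<Rightarrow> ('a \<Rightarrow> 'a) \<Rightarrow> nat \<Rightarrow> 'a \<Rightarrow> (nat \<Rightarrow> real) \<Rightarrow> real" where
  "gibbs_weight \<beta> J f T n x \<sigma> =
     exp (\<beta> * J / (2 * real n) * (magnetization n \<sigma>)\<^sup>2) *
     (\<Prod>i=1..n. spin_prob (f ((T ^^ i) x)) (\<sigma> i))"

definition gibbs ::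
    "real \<Rightarrow> real \<Rightarrow> ('a \<Rightarrow> real) \<Rightarrow> ('a \<Rightarrow> 'a) \<Rightarrow> nat \<Rightarrow> 'a \<Rightarrow> (nat \<Rightarrow> real) measure" where
  "gibbs \<beta> J f T n x =
     point_measure (configs n)
       (\<lambda>\<sigma>. ennreal (gibbs_weight \<beta> J f T n x \<sigma> /
                      (\<Sum>\<tau>\<in>configs n. gibbs_weight \<beta> J f T n x \<tau>)))"

definition L :: "real \<Rightarrow> real \<Rightarrow> real" where
  "L \<phi> s = ln (\<phi> * exp s + (1 - \<phi>) * exp (- s))"

definition G :: "real \<Rightarrow> real \<Rightarrow> ('a \<Rightarrow> real) \<Rightarrow> 'a measure \<Rightarrow> real \<Rightarrow> real" where
  "G \<beta> J f \<mu> s = \<beta> * J / 2 * s\<^sup>2 - (\<integral>y. L (f y) (\<beta> * J * s) \<partial>\<mu>)"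

text \<open>The type is a relation because the minimum of the set below is only
  meaningful once that set is known to be nonempty.\<close>

definition has_type :: "(real \<Rightarrow> real) \<Rightarrow> real \<Rightarrow> nat \<Rightarrow> bool" where
  "has_type g m r \<longleftrightarrow>
     r \<in> {j. 1 \<le> j \<and> (deriv ^^ j) g m \<noteq> 0} \<and>
     (\<forall>j \<in> {j. 1 \<le> j \<and> (deriv ^^ j) g m \<noteq> 0}. r \<le> j)"

text \<open>In the degenerate case \<open>k = 1\<close>, \<open>lam = \<beta> * J\<close> (which happens precisely when \<open>f\<close>
  takes values in \<open>{0, 1}\<close> almost everywhere) the formula for \<open>k = 1\<close> reads \<open>1 / 0\<close>.
  Computing in \<open>ereal\<close>, where \<open>inverse 0 = \<infinity>\<close>, it gives \<open>\<infinity>\<close>, and the law with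
  parameter \<open>\<infinity>\<close> is the point mass at \<open>0\<close>, the limit of the laws with finite
  parameter tending to \<open>\<infinity>\<close>.  In all other cases the parameter is real.\<close>

definition tilde_lambda :: "real \<Rightarrow> real \<Rightarrow> nat \<Rightarrow> real \<Rightarrow> ereal" where
  "tilde_lambda \<beta> J k lam =
     (if k = 1 then inverse (ereal (1 / lam - 1 / (\<beta> * J))) else ereal lam)"

definition Z_density :: "nat \<Rightarrow> real \<Rightarrow> real \<Rightarrow> real" where
  "Z_density r l s =
     exp (- l * s ^ r / fact r) / (\<integral>t. exp (- l * t ^ r / fact r) \<partial>lborel)"

definition Z_law :: "nat \<Rightarrow> ereal \<Rightarrow> real measure" where
  "Z_law r l =
     (if l = \<infinity> then return borel 0
      else density lborel (\<lambda>s. ennreal (Z_density r (real_of_ereal l) s)))"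

end

theory Submission
  imports Defs
begin

text \<open>
  Adding to \<open>M\<^sub>n\<close> an independent centred Gaussian of variance \<open>n / (\<beta> J)\<close> (Hubbard--Stratonovich)
  gives a variable whose density at \<open>n v\<close> is proportional to \<open>exp (- n G\<^sub>n(v))\<close>, where \<open>G\<^sub>n\<close> is \<open>G\<close>
  with the integral against \<open>\<mu>\<close> replaced by the average over the first \<open>n\<close> points of the orbit of \<open>x\<close>.
  With \<open>v = m + s n\<^sup>-\<^sup>1\<^sup>/\<^sup>2\<^sup>k\<close>, Taylor's formula and the \<open>\<C>\<close>-hypotheses give
  \<open>n (G\<^sub>n(v) - G\<^sub>n(m)) \<rightarrow> \<lambda> s\<^sup>2\<^sup>k / (2k)!\<close>.  Unique ergodicity gives \<open>G\<^sub>n \<rightarrow> G\<close> locally uniformly, which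
  bounds this quantity below by a quadratic in \<open>s\<close>, so the Fourier transforms converge by dominated
  convergence.  The Gaussian disappears in the limit if \<open>k \<ge> 2\<close> and is divided out of the
  characteristic function if \<open>k = 1\<close>; Levy's continuity theorem concludes.
\<close>

section \<open>Derivatives of the log-moment function\<close>

text \<open>Only the ratio of the Fourier integral at t to the one at 0 is needed, so the partition
  function and the value n G_n(m) cancel; this is why assumptions on orders j \<ge> 1 suffice. Up to
  the factor 1/j!, the j-th Taylor coefficient in s of n G_n(m + s n^(-1/2k)) is n^(1-j/2k) G^(j)(m)
  minus (\<beta>J)^j n^(-j/2k) times the centred orbit sum of order j. The class exponent j/(2k) is
  exactly what kills the second term, and the type leaves G^(2k)(m) alone in the first. These
  hypotheses see only the point m, while dominated convergence needs a lower bound for all s at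
  once, uniform in n. Taylor control ends at |s| of order n^(1/2k); farther out only the growth of
  G_n is available, and a quadratic rate survives the scaling because n n^(-1/k) \<ge> 1. That
  growth must hold along the orbit of the given x, not of almost every point, whence unique
  ergodicity. To keep constants independent of n, G and G_n are both instances of one function,
  \<open>potential\<close>, of a probability measure and a [0,1]-valued function.\<close>

definition tilted_mean :: "real \<Rightarrow> real \<Rightarrow> real" where
  "tilted_mean \<phi> s = (\<phi> * exp s - (1 - \<phi>) * exp (- s)) / (\<phi> * exp s + (1 - \<phi>) * exp (- s))"

lemma tilted_weight_pos:
  assumes "\<phi> \<in> {0..1}"
  shows "\<phi> * exp s + (1 - \<phi>) * exp (- s) > (0::real)"
proof (cases "\<phi> = 0")
  case False
  then have "\<phi> * exp s > 0" "(1 - \<phi>) * exp (- s) \<ge> 0" using assms by auto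
  then show ?thesis by linarith
qed simp

lemma DERIV_L:
  assumes "\<phi> \<in> {0..1}"
  shows "(L \<phi> has_real_derivative tilted_mean \<phi> s) (at s)"
proof -
  have "((\<lambda>s. ln (\<phi> * exp s + (1 - \<phi>) * exp (- s))) has_real_derivative tilted_mean \<phi> s) (at s)"
    using tilted_weight_pos[OF assms, of s]
    by (auto intro!: derivative_eq_intros simp: tilted_mean_def field_simps)
  then show ?thesis by (simp add: L_def[abs_def])
qed

text \<open>\<open>tilted_mean \<phi> s\<close> is the mean of a spin that is 1 with weight \<phi>
  e^s and -1 with weight (1 - \<phi>) e^(-s). Differentiating a mean in its tilt gives the variance,
  and a sign of mean u has variance 1 - u^2.\<close>

lemma DERIV_tilted_mean:
  assumes "\<phi> \<in> {0..1}"
  shows "(tilted_mean \<phi> has_real_derivative 1 - (tilted_mean \<phi> s)\<^sup>2) (at s)"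
proof -
  define p q where "p = \<phi> * exp s - (1 - \<phi>) * exp (- s)"
    and "q = \<phi> * exp s + (1 - \<phi>) * exp (- s)"
  have q: "q \<noteq> 0" using tilted_weight_pos[OF assms, of s] by (simp add: q_def)
  have "((\<lambda>s. (\<phi> * exp s - (1 - \<phi>) * exp (- s)) / (\<phi> * exp s + (1 - \<phi>) * exp (- s)))
      has_real_derivative (q * q - p * p) / (q * q)) (at s)"
    using q unfolding p_def q_def by (intro DERIV_divide) (auto intro!: derivative_eq_intros)
  also have "(q * q - p * p) / (q * q) = 1 - (tilted_mean \<phi> s)\<^sup>2"
    using q by (simp add: tilted_mean_def p_def[symmetric] q_def[symmetric] power2_eq_square diff_divide_distrib)
  finally have "((\<lambda>s. (\<phi> * exp s - (1 - \<phi>) * exp (- s)) / (\<phi> * exp s + (1 - \<phi>) * exp (- s)))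
      has_real_derivative 1 - (tilted_mean \<phi> s)\<^sup>2) (at s)" .
  then show ?thesis by (simp add: tilted_mean_def[abs_def])
qed

lemma tilted_mean_bounds:
  assumes "\<phi> \<in> {0..1}"
  shows "tilted_mean \<phi> s \<in> {-1..1}"
proof -
  have "\<phi> * exp s \<ge> 0" "(1 - \<phi>) * exp (- s) \<ge> 0" using assms by auto
  then show ?thesis using tilted_weight_pos[OF assms, of s]
    by (simp add: tilted_mean_def divide_le_eq le_divide_eq)
qed

primrec L_poly :: "nat \<Rightarrow> real poly" where
  "L_poly 0 = [:0, 1:]"
| "L_poly (Suc j) = pderiv (L_poly j) * [:1, 0, -1:]"

text \<open>The higher derivatives of \<open>L \<phi>\<close> are polynomials in the first one, because
  \<open>u = tilted_mean \<phi>\<close> solves the Riccati equation \<open>u' = 1 - u\<^sup>2\<close>.\<close>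

definition L_deriv :: "nat \<Rightarrow> real \<Rightarrow> real \<Rightarrow> real" where
  "L_deriv j \<phi> s = (case j of 0 \<Rightarrow> L \<phi> s | Suc i \<Rightarrow> poly (L_poly i) (tilted_mean \<phi> s))"

lemma L_deriv_simps [simp]:
  "L_deriv 0 \<phi> s = L \<phi> s"
  "L_deriv (Suc j) \<phi> s = poly (L_poly j) (tilted_mean \<phi> s)"
  by (simp_all add: L_deriv_def)

lemma DERIV_L_deriv:
  assumes "\<phi> \<in> {0..1}"
  shows "(L_deriv j \<phi> has_real_derivative L_deriv (Suc j) \<phi> s) (at s)"
proof (cases j)
  case 0
  then show ?thesis using DERIV_L[OF assms] by (simp add: L_deriv_def[abs_def])
next
  case (Suc i)
  have "((\<lambda>s. poly (L_poly i) (tilted_mean \<phi> s)) has_real_derivative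
      poly (pderiv (L_poly i)) (tilted_mean \<phi> s) * (1 - (tilted_mean \<phi> s)\<^sup>2)) (at s)"
    by (rule DERIV_chain2[OF poly_DERIV DERIV_tilted_mean[OF assms]])
  then show ?thesis using Suc by (simp add: L_deriv_def[abs_def] power2_eq_square algebra_simps)
qed

lemma iterated_deriv_eqI:
  fixes D :: "nat \<Rightarrow> real \<Rightarrow> real"
  assumes "\<And>j s. (D j has_real_derivative D (Suc j) s) (at s)"
  shows "(deriv ^^ j) (D 0) = D j"
proof (induction j)
  case (Suc j)
  have "deriv (D j) = D (Suc j)"
    using assms by (intro ext DERIV_imp_deriv)
  then show ?case by (simp add: Suc)
qed simp

lemma iterated_deriv_L:
  assumes "\<phi> \<in> {0..1}"
  shows "(deriv ^^ j) (L \<phi>) = L_deriv j \<phi>"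
proof -
  have "L_deriv 0 \<phi> = L \<phi>" by (simp add: fun_eq_iff)
  then show ?thesis
    using iterated_deriv_eqI[of "\<lambda>j. L_deriv j \<phi>", OF DERIV_L_deriv[OF assms]] by simp
qed

text \<open>\<open>tilted_mean\<close> never leaves [-1,1], where a polynomial is bounded; hence one
  constant for all \<phi> and s. It dominates difference quotients and bounds Taylor
  remainders.\<close>

lemma L_deriv_bounded:
  "\<exists>B>0. \<forall>\<phi>\<in>{0..1}. \<forall>s. \<bar>L_deriv (Suc j) \<phi> s\<bar> \<le> B"
proof -
  have "compact (poly (L_poly j) ` {-1..1})"
    by (intro compact_continuous_image continuous_intros compact_Icc)
  then obtain B where B: "B > 0" "\<And>u. u \<in> {-1..1} \<Longrightarrow> \<bar>poly (L_poly j) u\<bar> \<le> B"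
    by (metis bounded_pos compact_imp_bounded image_eqI real_norm_def)
  then show ?thesis by (metis L_deriv_simps(2) tilted_mean_bounds)
qed

lemma exp_L:
  assumes "\<phi> \<in> {0..1}"
  shows "exp (L \<phi> s) = \<phi> * exp s + (1 - \<phi>) * exp (- s)"
  using tilted_weight_pos[OF assms, of s] by (simp add: L_def)

text \<open>A convex combination of e^s and e^(-s) lies between e^(-|s|) and e^|s|.\<close>

lemma abs_L_le:
  assumes "\<phi> \<in> {0..1}"
  shows "\<bar>L \<phi> s\<bar> \<le> \<bar>s\<bar>"
proof -
  have "exp s \<le> exp \<bar>s\<bar>" "exp (-s) \<le> exp \<bar>s\<bar>" "exp (-\<bar>s\<bar>) \<le> exp s" "exp (-\<bar>s\<bar>) \<le> exp (-s)"
    by auto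
  then have "\<phi> * exp s + (1 - \<phi>) * exp (- s) \<le> \<phi> * exp \<bar>s\<bar> + (1 - \<phi>) * exp \<bar>s\<bar>"
    "\<phi> * exp s + (1 - \<phi>) * exp (- s) \<ge> \<phi> * exp (-\<bar>s\<bar>) + (1 - \<phi>) * exp (-\<bar>s\<bar>)"
    using assms by (intro add_mono mult_left_mono; simp)+
  then have "\<phi> * exp s + (1 - \<phi>) * exp (- s) \<le> exp \<bar>s\<bar>"
    "exp (-\<bar>s\<bar>) \<le> \<phi> * exp s + (1 - \<phi>) * exp (- s)"
    by (simp_all add: algebra_simps)
  then have "exp (L \<phi> s) \<le> exp \<bar>s\<bar>" "exp (-\<bar>s\<bar>) \<le> exp (L \<phi> s)"
    by (simp_all only: exp_L[OF assms])
  then show ?thesis by simp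
qed

lemma L_lipschitz:
  assumes "\<phi> \<in> {0..1}"
  shows "\<bar>L \<phi> s - L \<phi> t\<bar> \<le> \<bar>s - t\<bar>"
proof -
  have "norm (L \<phi> s - L \<phi> t) \<le> 1 * norm (s - t)"
    by (rule field_differentiable_bound[of UNIV])
       (use tilted_mean_bounds[OF assms] DERIV_L[OF assms] in \<open>auto simp: abs_le_iff\<close>)
  then show ?thesis by simp
qed

lemma measurable_L_deriv [measurable (raw)]:
  assumes [measurable]: "\<phi> \<in> borel_measurable M" "s \<in> borel_measurable M"
  shows "(\<lambda>y. L_deriv j (\<phi> y) (s y)) \<in> borel_measurable M"
proof (cases j)
  case 0
  then show ?thesis by (simp add: L_def)
next
  case (Suc i)
  have [measurable]: "poly (L_poly i) \<in> borel_measurable borel"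
    by (intro borel_measurable_continuous_onI continuous_intros)
  have [measurable]: "(\<lambda>y. tilted_mean (\<phi> y) (s y)) \<in> borel_measurable M"
    unfolding tilted_mean_def by measurable
  show ?thesis unfolding Suc L_deriv_simps by measurable
qed

lemma continuous_on_L_deriv:
  assumes "\<And>y. y \<in> S \<Longrightarrow> \<phi> y \<in> {0..1}" "continuous_on S \<phi>"
  shows "continuous_on S (\<lambda>y. L_deriv j (\<phi> y) s)"
proof -
  have nz: "\<phi> y * exp s + (1 - \<phi> y) * exp (- s) \<noteq> 0" if "y \<in> S" for y
    using tilted_weight_pos[OF assms(1)[OF that], of s] by simp
  show ?thesis
  proof (cases j)
    case 0
    show ?thesis unfolding 0 L_deriv_simps L_def
      by (intro continuous_intros assms(2)) (use nz in auto)
  next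
    case (Suc i)
    have "continuous_on S (\<lambda>y. tilted_mean (\<phi> y) s)" unfolding tilted_mean_def
      by (intro continuous_intros assms(2)) (use nz in auto)
    then show ?thesis unfolding Suc L_deriv_simps by (intro continuous_intros)
  qed
qed

section \<open>Unique ergodicity and convergence of orbit averages\<close>

definition cantor_code :: "(nat \<Rightarrow> bool) \<Rightarrow> real" where
  "cantor_code a = (\<Sum>i. 2 / 3 ^ Suc i * of_bool (a i))"

lemma cantor_weights_sums: "(\<lambda>i. 2 / 3 ^ Suc (i + n) :: real) sums (1 / 3 ^ n)"
proof -
  have "(\<lambda>i. 2 / 3 ^ Suc n * (1 / 3) ^ i :: real) sums (2 / 3 ^ Suc n * (1 / (1 - 1 / 3)))"
    by (intro sums_mult geometric_sums) simp
  then show ?thesis by (simp add: power_add power_divide mult.commute mult.left_commute)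
qed

lemma cantor_code_summable: "summable (\<lambda>i. 2 / 3 ^ Suc i * of_bool (a i) :: real)"
  by (rule summable_comparison_test'[OF sums_summable[OF cantor_weights_sums[of 0]]]) simp

lemma cantor_code_in: "cantor_code a \<in> {0..1}"
proof -
  have "cantor_code a \<le> (\<Sum>i. 2 / 3 ^ Suc i)"
    unfolding cantor_code_def using sums_summable[OF cantor_weights_sums[of 0]]
    by (intro suminf_le cantor_code_summable) auto
  moreover have "cantor_code a \<ge> 0"
    unfolding cantor_code_def by (intro suminf_nonneg cantor_code_summable) auto
  ultimately show ?thesis using sums_unique[OF cantor_weights_sums[of 0]] by simp
qed

text \<open>The ternary digits are 0 and 2, so the first disagreement, at index i0, contributes
  2/3^(i0+1), while all later digits together can undo at most half of it. Codes that disagree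
  before N are therefore at least 3^(-N) apart; binary digits would leave no such gap.\<close>

lemma cantor_code_gap:
  assumes "\<bar>cantor_code a - cantor_code b\<bar> < 1 / 3 ^ N" "i < N"
  shows "a i = b i"
proof (rule ccontr)
  assume "a i \<noteq> b i"
  define i0 where "i0 = (LEAST i. a i \<noteq> b i)"
  have i0: "a i0 \<noteq> b i0" unfolding i0_def by (rule LeastI) (rule \<open>a i \<noteq> b i\<close>)
  have below: "a l = b l" if "l < i0" for l
    using not_less_Least[of l "\<lambda>i. a i \<noteq> b i"] that unfolding i0_def by blast
  have "i0 \<le> i" unfolding i0_def by (rule Least_le) (rule \<open>a i \<noteq> b i\<close>)
  define g :: "nat \<Rightarrow> real" where
    "g l = 2 / 3 ^ Suc l * of_bool (a l) - 2 / 3 ^ Suc l * of_bool (b l)" for l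
  have g: "summable g" "cantor_code a - cantor_code b = suminf g"
    unfolding g_def cantor_code_def
    by (intro summable_diff cantor_code_summable, intro suminf_diff cantor_code_summable)
  have gb: "norm (g l) \<le> 2 / 3 ^ Suc l" for l by (auto simp: g_def)
  have "suminf g = (\<Sum>l. g (l + Suc i0)) + (\<Sum>l<Suc i0. g l)"
    by (rule suminf_split_initial_segment[OF g(1)])
  also have "(\<Sum>l<Suc i0. g l) = g i0"
    using below by (simp add: g_def)
  finally have "\<bar>g i0\<bar> \<le> \<bar>suminf g\<bar> + \<bar>\<Sum>l. g (l + Suc i0)\<bar>" by linarith
  moreover have "\<bar>g i0\<bar> = 2 / 3 ^ Suc i0" using i0 by (cases "a i0"; cases "b i0") (auto simp: g_def)
  moreover have "\<bar>\<Sum>l. g (l + Suc i0)\<bar> \<le> (\<Sum>l. 2 / 3 ^ Suc (l + Suc i0))"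
    unfolding real_norm_def[symmetric]
    by (rule norm_suminf_le[OF gb sums_summable[OF cantor_weights_sums]])
  moreover have "(\<Sum>l. 2 / 3 ^ Suc (l + Suc i0) :: real) = 1 / 3 ^ Suc i0"
    by (rule sums_unique[OF cantor_weights_sums, symmetric])
  ultimately have "1 / 3 ^ Suc i0 \<le> \<bar>cantor_code a - cantor_code b\<bar>" using g(2) by simp
  moreover have "(1::real) / 3 ^ N \<le> 1 / 3 ^ Suc i0"
    using \<open>i0 \<le> i\<close> assms(2) by (intro divide_left_mono power_increasing) auto
  ultimately show False using assms(1) by linarith
qed

text \<open>The ternary digits of \<open>c y\<close> record membership of \<open>y\<close> in a countable family of balls that
  contains finite covers of \<open>E\<close> at every scale.\<close>

lemma compact_real_code:
  fixes E :: "'a::metric_space set"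
  assumes "compact E" "E \<noteq> {}"
  obtains c :: "'a \<Rightarrow> real" where "\<And>y. c y \<in> {0..1}"
    "\<And>\<epsilon>. \<epsilon> > 0 \<Longrightarrow> \<exists>\<eta>>0. \<forall>y\<in>E. \<forall>y'\<in>E. \<bar>c y - c y'\<bar> < \<eta> \<longrightarrow> dist y y' < \<epsilon>"
proof -
  have "\<exists>F. finite F \<and> E \<subseteq> (\<Union>x\<in>F. ball x (1 / real (Suc j)))" for j
  proof -
    have "1 / real (Suc j) > 0" by simp
    then show ?thesis using assms(1) unfolding compact_eq_totally_bounded by blast
  qed
  then have "\<exists>F. \<forall>j. finite (F j) \<and> E \<subseteq> (\<Union>x\<in>F j. ball x (1 / real (Suc j)))"
    by (intro choice allI)
  then obtain F where F: "\<And>j. finite (F j)" "\<And>j. E \<subseteq> (\<Union>x\<in>F j. ball x (1 / real (Suc j)))"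
    by blast
  define D where "D = (SIGMA j:UNIV. F j)"
  have cD: "countable D"
    unfolding D_def using F(1) by (intro countable_SIGMA) (auto intro: countable_finite)
  define U where "U i = (case from_nat_into D i of (j, d) \<Rightarrow> ball d (1 / real (Suc j)))" for i
  define c where "c y = cantor_code (\<lambda>i. y \<in> U i)" for y
  show ?thesis
  proof
    show "c y \<in> {0..1}" for y unfolding c_def by (rule cantor_code_in)
    fix \<epsilon> :: real assume "\<epsilon> > 0"
    then obtain j where "1 / real (Suc j) < \<epsilon> / 2" using nat_approx_posE[of "\<epsilon> / 2"] by auto
    then have j: "2 * (1 / real (Suc j)) < \<epsilon>" by linarith
    \<comment> \<open>N exceeds the index of each of the finitely many balls of radius 1/(j+1).
      Codes closer than 3^(-N) then agree on membership in all of them, and one of these balls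
      contains y, hence also y'.\<close>
    obtain N where N: "\<And>i. i \<in> (\<lambda>d. to_nat_on D (j, d)) ` F j \<Longrightarrow> i < N"
      using finite_imageI[OF F(1), of "\<lambda>d. to_nat_on D (j, d)" j]
      unfolding finite_nat_set_iff_bounded by auto
    show "\<exists>\<eta>>0. \<forall>y\<in>E. \<forall>y'\<in>E. \<bar>c y - c y'\<bar> < \<eta> \<longrightarrow> dist y y' < \<epsilon>"
    proof (intro exI[of _ "1 / 3 ^ N"] conjI ballI impI)
      fix y y' assume y: "y \<in> E" "y' \<in> E" "\<bar>c y - c y'\<bar> < 1 / 3 ^ N"
      obtain d where d: "d \<in> F j" "y \<in> ball d (1 / real (Suc j))" using F(2)[of j] y(1) by blast
      define i where "i = to_nat_on D (j, d)"
      have "i < N" using N d(1) by (simp add: i_def)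
      have "(j, d) \<in> D" using d(1) by (simp add: D_def)
      then have "from_nat_into D i = (j, d)"
        unfolding i_def by (rule from_nat_into_to_nat_on[OF cD])
      then have U: "U i = ball d (1 / real (Suc j))" by (simp add: U_def)
      have "y \<in> U i \<longleftrightarrow> y' \<in> U i"
        using cantor_code_gap[OF _ \<open>i < N\<close>, of "\<lambda>i. y \<in> U i" "\<lambda>i. y' \<in> U i"] y(3)
        by (simp add: c_def)
      then have "dist d y < 1 / real (Suc j)" "dist d y' < 1 / real (Suc j)" using d(2) U by auto
      then show "dist y y' < \<epsilon>" using dist_triangle3[of y y' d] j by linarith
    qed simp
  qed
qed

lemma compact_image_of_real_compact:
  fixes E :: "'a::metric_space set"
  assumes "compact E" "E \<noteq> {}"
  obtains K :: "real set" and c \<pi> where "compact K" "c ` E \<subseteq> K" "continuous_on K \<pi>" "\<pi> ` K \<subseteq> E"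
    "\<And>y. y \<in> E \<Longrightarrow> \<pi> (c y) = (y :: 'a)"
proof -
  obtain c :: "'a \<Rightarrow> real" where c: "\<And>y. c y \<in> {0..1}"
    "\<And>\<epsilon>. \<epsilon> > 0 \<Longrightarrow> \<exists>\<eta>>0. \<forall>y\<in>E. \<forall>y'\<in>E. \<bar>c y - c y'\<bar> < \<eta> \<longrightarrow> dist y y' < \<epsilon>"
    using compact_real_code[OF assms] by blast
  define K where "K = closure (c ` E)"
  \<comment> \<open>Graph of the extended decoding, kept as a relation until it is shown total on K
    (\<open>ex\<close>, by compactness of E). The estimate \<open>close\<close> makes it
    single-valued and uniformly continuous.\<close>
  define R where "R z y \<longleftrightarrow> y \<in> E \<and> (\<exists>s. (\<forall>n. s n \<in> E) \<and> (\<lambda>n. c (s n)) \<longlonglongrightarrow> z \<and> s \<longlonglongrightarrow> y)" for z y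
  have close: "\<exists>\<eta>>0. \<forall>z y z' y'. R z y \<and> R z' y' \<and> \<bar>z - z'\<bar> < \<eta> \<longrightarrow> dist y y' \<le> \<epsilon>"
    if pos: "\<epsilon> > 0" for \<epsilon>
  proof -
    obtain \<eta> where \<eta>: "\<eta> > 0" "\<And>y y'. y \<in> E \<Longrightarrow> y' \<in> E \<Longrightarrow> \<bar>c y - c y'\<bar> < \<eta> \<Longrightarrow> dist y y' < \<epsilon>"
      using c(2)[OF pos] by blast
    have "dist y y' \<le> \<epsilon>" if R: "R z y" "R z' y'" and z: "\<bar>z - z'\<bar> < \<eta>" for z y z' y'
    proof -
      obtain s s' where s: "\<And>n. s n \<in> E" "(\<lambda>n. c (s n)) \<longlonglongrightarrow> z" "s \<longlonglongrightarrow> y"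
        and s': "\<And>n. s' n \<in> E" "(\<lambda>n. c (s' n)) \<longlonglongrightarrow> z'" "s' \<longlonglongrightarrow> y'"
        using R unfolding R_def by blast
      have "(\<lambda>n. \<bar>c (s n) - c (s' n)\<bar>) \<longlonglongrightarrow> \<bar>z - z'\<bar>"
        by (rule tendsto_rabs[OF tendsto_diff[OF s(2) s'(2)]])
      then have "eventually (\<lambda>n. \<bar>c (s n) - c (s' n)\<bar> < \<eta>) sequentially"
        using z by (rule order_tendstoD)
      then have "eventually (\<lambda>n. dist (s n) (s' n) \<le> \<epsilon>) sequentially"
        by eventually_elim (rule less_imp_le[OF \<eta>(2)[OF s(1) s'(1)]])
      moreover have "(\<lambda>n. dist (s n) (s' n)) \<longlonglongrightarrow> dist y y'" by (rule tendsto_dist[OF s(3) s'(3)])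
      ultimately show ?thesis
        by (intro tendsto_upperbound[OF _ _ sequentially_bot])
    qed
    then show ?thesis using \<eta>(1) by blast
  qed
  have ex: "\<exists>y. R z y" if zK: "z \<in> K" for z
  proof -
    obtain t where t: "\<And>n. t n \<in> c ` E" "t \<longlonglongrightarrow> z"
      using zK unfolding K_def closure_sequential by blast
    then have "\<forall>n. \<exists>y\<in>E. t n = c y" by blast
    then obtain s where s: "\<And>n. s n \<in> E" "\<And>n. t n = c (s n)" by metis
    obtain y r where y: "y \<in> E" "strict_mono r" "(s \<circ> r) \<longlonglongrightarrow> y"
      using seq_compactE[OF compact_imp_seq_compact[OF assms(1)], of s] s(1) by metis
    have "(t \<circ> r) \<longlonglongrightarrow> z" by (rule LIMSEQ_subseq_LIMSEQ[OF t(2) y(2)])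
    then have "(\<lambda>n. c ((s \<circ> r) n)) \<longlonglongrightarrow> z" by (simp add: o_def s(2))
    moreover have "\<forall>n. (s \<circ> r) n \<in> E" using s(1) by simp
    ultimately have "R z y" unfolding R_def using y(1,3) by blast
    then show ?thesis ..
  qed
  define \<pi> where "\<pi> z = (SOME y. R z y)" for z
  have \<pi>: "R z (\<pi> z)" if "z \<in> K" for z unfolding \<pi>_def using ex[OF that] by (rule someI_ex)
  show ?thesis
  proof (rule that[of K c \<pi>])
    have "bounded K"
    proof -
      have "c ` E \<subseteq> {0..1}" using c(1) by blast
      then show ?thesis
        unfolding K_def by (intro bounded_closure bounded_subset[OF bounded_closed_interval])
    qed
    then show "compact K" unfolding K_def compact_eq_bounded_closed by simp
    show cK: "c ` E \<subseteq> K" unfolding K_def by (rule closure_subset)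
    have "\<pi> z \<in> E" if "z \<in> K" for z using \<pi>[OF that] unfolding R_def by (rule conjunct1)
    then show "\<pi> ` K \<subseteq> E" by (rule image_subsetI)
    show "continuous_on K \<pi>"
      unfolding continuous_on_iff
    proof (intro ballI allI impI)
      fix z \<epsilon> :: real assume z: "z \<in> K" "\<epsilon> > 0"
      \<comment> \<open>Passing to limits left \<open>close\<close> with a weak inequality; halving
        \<epsilon> restores the strict one.\<close>
      obtain \<eta> where "\<eta> > 0" "\<forall>z y z' y'. R z y \<and> R z' y' \<and> \<bar>z - z'\<bar> < \<eta> \<longrightarrow> dist y y' \<le> \<epsilon> / 2"
        using close[OF half_gt_zero[OF z(2)]] by blast
      then have le: "dist (\<pi> z') (\<pi> z) \<le> \<epsilon> / 2" if "z' \<in> K" "dist z' z < \<eta>" for z'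
        using \<pi>[OF that(1)] \<pi>[OF z(1)] that(2) unfolding dist_real_def by blast
      have "dist (\<pi> z') (\<pi> z) < \<epsilon>" if "z' \<in> K" "dist z' z < \<eta>" for z'
        using le[OF that] z(2) by linarith
      then show "\<exists>d>0. \<forall>z'\<in>K. dist z' z < d \<longrightarrow> dist (\<pi> z') (\<pi> z) < \<epsilon>"
        using \<open>\<eta> > 0\<close> by blast
    qed
    fix y assume y: "y \<in> E"
    then have "R (c y) y" unfolding R_def
      by (intro conjI exI[of _ "\<lambda>n. y"] allI tendsto_const)
    moreover have "R (c y) (\<pi> (c y))" using \<pi> cK y by blast
    ultimately have le: "dist (\<pi> (c y)) y \<le> \<epsilon>" if "\<epsilon> > 0" for \<epsilon>
    proof -
      obtain \<eta> where "\<eta> > 0" "\<forall>z y z' y'. R z y \<and> R z' y' \<and> \<bar>z - z'\<bar> < \<eta> \<longrightarrow> dist y y' \<le> \<epsilon>"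
        using close[OF \<open>\<epsilon> > 0\<close>] by blast
      moreover have "\<bar>c y - c y\<bar> < \<eta>" using \<open>\<eta> > 0\<close> by simp
      ultimately show ?thesis using \<open>R (c y) y\<close> \<open>R (c y) (\<pi> (c y))\<close> by blast
    qed
    have "dist (\<pi> (c y)) y \<le> 0"
      by (rule field_le_epsilon) (simp only: add_0_left le)
    then show "\<pi> (c y) = y" by simp
  qed
qed

section \<open>Determining measures on \<open>E\<close> by continuous functions\<close>

lemma sets_restrict_borel_closed:
  assumes "closed E"
  shows "sets (restrict_space borel E) = sigma_sets E {C. closed C \<and> C \<subseteq> E}"
proof -
  have "sets (restrict_space borel E) = (\<inter>) E ` sigma_sets UNIV (Collect closed)"
    by (simp add: sets_restrict_space borel_eq_closed)
  also have "\<dots> = sigma_sets E ((\<inter>) E ` Collect closed)"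
    using assms by (intro sigma_sets_Int) (auto intro: sigma_sets.Basic)
  also have "(\<inter>) E ` Collect closed = {C. closed C \<and> C \<subseteq> E}"
    using assms by (auto intro!: image_eqI closed_Int)
  finally show ?thesis .
qed

text \<open>The indicator of a nonempty closed C is the pointwise limit of the continuous functions
  max 0 (1 - n dist(y,C)), so the integrals determine the measures of closed sets, an
  intersection-stable generator.\<close>

lemma measure_eqI_continuous_integrals:
  fixes E :: "'a::metric_space set"
  assumes E: "closed E" and N: "prob_space N" "prob_space N'"
    and sets: "sets N = sets (restrict_space borel E)" "sets N' = sets (restrict_space borel E)"
    and eq: "\<And>g::'a \<Rightarrow> real. continuous_on E g \<Longrightarrow> (\<And>y. \<bar>g y\<bar> \<le> 1) \<Longrightarrow> integral\<^sup>L N g = integral\<^sup>L N' g"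
  shows "N = N'"
proof -
  interpret N: prob_space N by fact
  interpret N': prob_space N' by fact
  have cont: "continuous_on S (\<lambda>y. max 0 (1 - real n * infdist y C))" for S C n
    by (intro continuous_on_max continuous_on_const continuous_on_diff continuous_on_mult continuous_on_infdist continuous_on_id)
  have le1: "\<bar>max 0 (1 - real n * infdist y C)\<bar> \<le> 1" for n y C
    using mult_nonneg_nonneg[OF _ infdist_nonneg, of "real n" y C] by auto
  have lim: "(\<lambda>n. \<integral>y. max 0 (1 - real n * infdist y C) \<partial>M) \<longlonglongrightarrow> measure M C"
    if M: "prob_space M" "sets M = sets (restrict_space borel E)" and C: "closed C" "C \<subseteq> E" "C \<noteq> {}"
    for M C
  proof -
    interpret M: prob_space M by fact
    have CM: "C \<in> sets M" unfolding M(2) sets_restrict_borel_closed[OF E] using C by blast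
    have meas: "(\<lambda>y. max 0 (1 - real n * infdist y C)) \<in> borel_measurable M" for n
      unfolding measurable_cong_sets[OF M(2) refl]
      by (rule borel_measurable_continuous_on_restrict[OF cont])
    have "(\<lambda>n. \<integral>y. max 0 (1 - real n * infdist y C) \<partial>M) \<longlonglongrightarrow> (\<integral>y. indicator C y \<partial>M)"
    proof (rule integral_dominated_convergence[where w = "\<lambda>_. 1"])
      show "AE y in M. (\<lambda>n. max 0 (1 - real n * infdist y C)) \<longlonglongrightarrow> indicator C y"
      proof (rule AE_I2)
        fix y
        show "(\<lambda>n. max 0 (1 - real n * infdist y C)) \<longlonglongrightarrow> indicator C y"
        proof (cases "y \<in> C")
          case False
          then have pos: "infdist y C > 0"
            using in_closed_iff_infdist_zero[OF C(1,3)] infdist_nonneg[of y C] by fastforce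
          obtain n0 where "1 / infdist y C < real n0" using reals_Archimedean2 by blast
          then have n0: "1 < real n0 * infdist y C" using pos by (simp add: divide_less_eq)
          have "max 0 (1 - real n * infdist y C) = 0" if "n \<ge> n0" for n
          proof -
            have "real n0 * infdist y C \<le> real n * infdist y C"
              using that pos by (intro mult_right_mono) auto
            then show ?thesis using n0 by simp
          qed
          then have "eventually (\<lambda>n. max 0 (1 - real n * infdist y C) = 0) sequentially"
            using eventually_sequentially by blast
          then show ?thesis using False by (simp add: tendsto_eventually)
        qed (simp add: in_closed_iff_infdist_zero[OF C(1,3)])
      qed
      show "AE y in M. norm (max 0 (1 - real n * infdist y C)) \<le> 1" for n
        unfolding real_norm_def by (rule AE_I2) (rule le1)
    qed (use meas CM in auto)
    then show ?thesis using CM by simp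
  qed
  show ?thesis
  proof (rule measure_eqI_generator_eq[where E = "{C. closed C \<and> C \<subseteq> E}" and \<Omega> = E and A = "\<lambda>_. E"])
    show "Int_stable {C. closed C \<and> C \<subseteq> E}" by (auto simp: Int_stable_def)
    show "emeasure N C = emeasure N' C" if "C \<in> {C. closed C \<and> C \<subseteq> E}" for C
    \<comment> \<open>\<open>infdist y {}\<close> is 0 by convention, so the approximating functions
      would be constantly 1 for the empty set.\<close>
    proof (cases "C = {}")
      case False
      have C: "closed C" "C \<subseteq> E" using that by auto
      have "(\<integral>y. max 0 (1 - real n * infdist y C) \<partial>N) = (\<integral>y. max 0 (1 - real n * infdist y C) \<partial>N')" for n
        using cont le1 by (rule eq)
      then have "measure N C = measure N' C"
        using lim[OF N(1) sets(1) C False] lim[OF N(2) sets(2) C False]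
        by (intro LIMSEQ_unique) simp_all
      then show ?thesis by (simp add: N.emeasure_eq_measure N'.emeasure_eq_measure)
    qed simp
  qed (use sets sets_restrict_borel_closed[OF E] E in auto)
qed


text \<open>The truncated distance to K is bounded and continuous and vanishes exactly on K. Its
  integral is 0 for every n, hence for the limit.\<close>

lemma AE_in_closed_weak_limit:
  assumes "\<And>n. real_distribution (\<mu> n)" "real_distribution M" "weak_conv_m \<mu> M"
    and K: "closed K" "K \<noteq> {}" and \<mu>: "\<And>n. AE z in \<mu> n. z \<in> K"
  shows "AE z in M. z \<in> K"
proof -
  interpret M: real_distribution M by fact
  have cont: "continuous_on S (\<lambda>z. min 1 (infdist z K))" for S
    by (intro continuous_on_min continuous_on_const continuous_on_infdist continuous_on_id)
  have meas: "(\<lambda>z. min 1 (infdist z K)) \<in> borel_measurable borel"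
    by (rule borel_measurable_continuous_onI[OF cont])
  have bd: "norm (min 1 (infdist z K)) \<le> 1" for z
    using infdist_nonneg[of z K] by auto
  have "(\<lambda>n. \<integral>z. min 1 (infdist z K) \<partial>\<mu> n) \<longlonglongrightarrow> (\<integral>z. min 1 (infdist z K) \<partial>M)"
    using assms(1-3) cont[of UNIV] bd
    by (intro weak_conv_imp_integral_bdd_continuous_conv) (auto simp: continuous_on_eq_continuous_at)
  moreover have "(\<integral>z. min 1 (infdist z K) \<partial>\<mu> n) = 0" for n
  proof -
    have "(\<integral>z. min 1 (infdist z K) \<partial>\<mu> n) = (\<integral>z. 0 \<partial>\<mu> n)"
    proof (rule integral_cong_AE)
      show "AE z in \<mu> n. min 1 (infdist z K) = 0" using \<mu>[of n] by eventually_elim simp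
      interpret real_distribution "\<mu> n" by (rule assms(1))
      show "(\<lambda>z. min 1 (infdist z K)) \<in> borel_measurable (\<mu> n)" using meas by simp
    qed simp
    then show ?thesis by simp
  qed
  ultimately have 0: "(\<integral>z. min 1 (infdist z K) \<partial>M) = 0"
    by (simp add: LIMSEQ_const_iff)
  have int: "integrable M (\<lambda>z. min 1 (infdist z K))"
    using meas bd by (intro M.integrable_const_bound[where B = 1]) auto
  have "AE z in M. min 1 (infdist z K) = 0"
    using 0 integral_nonneg_eq_0_iff_AE[OF int] infdist_nonneg[of _ K] by auto
  then show ?thesis
    by eventually_elim (use K infdist_nonneg in \<open>auto simp: in_closed_iff_infdist_zero min_def split: if_splits\<close>)
qed

section \<open>Empirical measures of an orbit\<close>

lemma funpow_in:
  assumes "T ` E \<subseteq> E" "x \<in> E"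
  shows "(T ^^ k) x \<in> E"
  using assms by (induction k) auto

lemma empirical_integral:
  fixes g :: "real \<Rightarrow> real"
  assumes "g \<in> borel_measurable borel"
  shows "integral\<^sup>L (distr (uniform_count_measure {1..Suc n}) borel z) g
    = (\<Sum>k=1..Suc n. g (z k)) / real (Suc n)"
proof -
  have "z \<in> uniform_count_measure {1..Suc n} \<rightarrow>\<^sub>M borel"
    by (simp add: measurable_def uniform_count_measure_def)
  then show ?thesis
    by (simp only: integral_distr[OF _ assms] integral_uniform_count_measure
        finite_atLeastAtMost card_atLeastAtMost diff_Suc_1)
qed

lemma real_distribution_empirical:
  "real_distribution (distr (uniform_count_measure {1..Suc n}) borel z)"
proof -
  interpret prob_space "uniform_count_measure {1..Suc n}"
    by (rule prob_space_uniform_count_measure) auto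
  show ?thesis
    by (rule real_distribution_distr) (simp add: measurable_def uniform_count_measure_def)
qed

lemma not_tendsto_subseq:
  fixes X :: "nat \<Rightarrow> real"
  assumes "\<not> X \<longlonglongrightarrow> l"
  obtains e s where "e > 0" "strict_mono s" "\<And>n :: nat. \<bar>X (s n) - l\<bar> \<ge> e"
proof -
  obtain e where e: "e > 0" "\<forall>N. \<exists>n\<ge>N. \<bar>X n - l\<bar> \<ge> e"
    using assms unfolding LIMSEQ_iff by (auto simp: not_less)
  then have "infinite {n. \<bar>X n - l\<bar> \<ge> e}" unfolding infinite_nat_iff_unbounded_le by blast
  then obtain s :: "nat \<Rightarrow> nat" where "strict_mono s" "\<And>n. s n \<in> {n. \<bar>X n - l\<bar> \<ge> e}"
    using infinite_enumerate by blast
  then show ?thesis using that[OF e(1)] by blast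
qed

text \<open>Krylov--Bogolyubov.  The empirical measures are coded on the real line, where Helly's
  theorem provides a weak limit, and the limit is decoded.\<close>

lemma uniquely_ergodic_averages:
  fixes E :: "'a::metric_space set" and g :: "'a \<Rightarrow> real"
  assumes E: "compact E" and T: "continuous_on E T" "T ` E \<subseteq> E"
    and erg: "uniquely_ergodic E T \<mu>" and g: "continuous_on E g" and x: "x \<in> E"
  shows "(\<lambda>n. (\<Sum>k=1..n. g ((T ^^ k) x)) / real n) \<longlonglongrightarrow> integral\<^sup>L \<mu> g"
proof (rule ccontr)
  define y where "y k = (T ^^ k) x" for k
  have yE: "y k \<in> E" for k unfolding y_def using T(2) x by (rule funpow_in)
  \<comment> \<open>\<open>Suc n\<close> points are averaged so that the empirical measure is a
    probability measure for every n, as \<open>tight\<close> demands.\<close>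
  define avg where "avg h n = (\<Sum>k=1..Suc n. h (y k)) / real (Suc n)" for h :: "'a \<Rightarrow> real" and n
  assume "\<not> ?thesis"
  then have "\<not> avg g \<longlonglongrightarrow> integral\<^sup>L \<mu> g"
    unfolding avg_def y_def by (subst (asm) filterlim_sequentially_Suc[symmetric]) simp
  then obtain e s where e: "e > 0" "strict_mono s" "\<And>n :: nat. \<bar>avg g (s n) - integral\<^sup>L \<mu> g\<bar> \<ge> e"
    using not_tendsto_subseq[of "avg g" "integral\<^sup>L \<mu> g"] by blast
  have "E \<noteq> {}" using x by blast
  then obtain K :: "real set" and c \<pi> where K: "compact K" "c ` E \<subseteq> K" "continuous_on K \<pi>" "\<pi> ` K \<subseteq> E"
    and \<pi>: "\<And>y. y \<in> E \<Longrightarrow> \<pi> (c y) = y"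
    using compact_image_of_real_compact[OF E] by blast
  have cK: "c (y k) \<in> K" for k using yE K(2) by blast
  have Kne: "K \<noteq> {}" and Kcl: "closed K" using cK compact_imp_closed[OF K(1)] by auto
  define emp where "emp n = distr (uniform_count_measure {1..Suc n}) borel (\<lambda>k. c (y k))" for n
  have emp: "real_distribution (emp n)" for n unfolding emp_def by (rule real_distribution_empirical)
  have empK: "AE z in emp n. z \<in> K'" if "K \<subseteq> K'" "K' \<in> sets borel" for n K'
  proof -
    have "(\<lambda>k. c (y k)) \<in> uniform_count_measure {1..Suc n} \<rightarrow>\<^sub>M borel"
      by (simp add: measurable_def uniform_count_measure_def)
    moreover have "{z \<in> space borel. z \<in> K'} \<in> sets borel" using that(2) by simp
    ultimately show ?thesis
      unfolding emp_def using that(1) cK by (simp only: AE_distr_iff) (rule AE_I2, blast)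
  qed
  obtain b where b: "b > 0" "K \<subseteq> {-b..b}"
  proof -
    obtain b where "b > 0" "\<And>z. z \<in> K \<Longrightarrow> \<bar>z\<bar> \<le> b"
      using compact_imp_bounded[OF K(1)] unfolding bounded_pos real_norm_def by blast
    then have "b > 0" "K \<subseteq> {-b..b}" by (auto simp: abs_le_iff) (metis minus_le_iff)
    then show ?thesis by (rule that)
  qed
  have "tight emp"
    unfolding tight_def
  proof (intro conjI allI impI emp)
    fix \<epsilon> :: real assume "\<epsilon> > 0"
    \<comment> \<open>\<open>tight\<close> uses half-open intervals, so the left end is moved below
      -b to include it.\<close>
    have "measure (emp n) {-b - 1<..b} = 1" for n
    proof -
      interpret real_distribution "emp n" by (rule emp)
      have "AE z in emp n. z \<in> {-b - 1<..b}" using b by (intro empK) auto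
      then show ?thesis by (intro prob_eq_1[THEN iffD2]) auto
    qed
    then show "\<exists>a b. a < b \<and> (\<forall>n. 1 - \<epsilon> < measure (emp n) {a<..b})"
      using \<open>\<epsilon> > 0\<close> b(1) by (intro exI[of _ "-b-1"] exI[of _ b]) auto
  qed
  then obtain r M where r: "strict_mono r" "real_distribution M" "weak_conv_m (emp \<circ> s \<circ> r) M"
    using tight_imp_convergent_subsubsequence[OF _ e(2)] by blast
  interpret M: real_distribution M by fact
  have MK: "AE z in M. z \<in> K"
    by (rule AE_in_closed_weak_limit[OF _ r(2,3) Kcl Kne])
       (use Kcl in \<open>simp_all only: comp_apply emp empK[OF order_refl] borel_closed\<close>)
  \<comment> \<open>The default x lies in E and makes the decoding a Borel map on the whole line; M
    gives no mass to the complement of K, where the default is used.\<close>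
  define \<pi>' where "\<pi>' z = (if z \<in> K then \<pi> z else x)" for z
  have \<pi>'E: "\<pi>' z \<in> E" for z using K(4) x by (auto simp: \<pi>'_def)
  have "\<pi>' \<in> borel_measurable borel"
    unfolding \<pi>'_def using Kcl K(3) by (intro borel_measurable_continuous_on_if) auto
  then have \<pi>'m: "\<pi>' \<in> M \<rightarrow>\<^sub>M restrict_space borel E"
    using \<pi>'E by (intro measurable_restrict_space2) auto
  define \<nu> where "\<nu> = distr M (restrict_space borel E) \<pi>'"
  have \<nu>: "prob_space \<nu>" "sets \<nu> = sets (restrict_space borel E)"
    unfolding \<nu>_def using \<pi>'m by (auto intro: M.prob_space_distr)
  have conv: "(\<lambda>n. avg h (s (r n))) \<longlonglongrightarrow> integral\<^sup>L \<nu> h" if h: "continuous_on E h" for h :: "'a \<Rightarrow> real"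
  proof -
    have hm: "h \<in> borel_measurable (restrict_space borel E)"
      by (rule borel_measurable_continuous_on_restrict[OF h])
    have "continuous_on K (h \<circ> \<pi>)"
      using continuous_on_compose[OF K(3)] continuous_on_subset[OF h K(4)] by blast
    moreover have "bounded ((h \<circ> \<pi>) ` K)"
      using calculation K(1) by (intro compact_imp_bounded compact_continuous_image)
    then obtain B where B: "B > 0" "\<And>z. z \<in> K \<Longrightarrow> norm ((h \<circ> \<pi>) z) \<le> B"
      unfolding bounded_pos by auto
    \<comment> \<open>Weak convergence on the line tests against bounded continuous functions on all
      of it, so h read through the decoding is extended from K with the same bound.\<close>
    ultimately obtain H where H: "continuous_on UNIV H" "\<And>z. z \<in> K \<Longrightarrow> H z = (h \<circ> \<pi>) z"
      "\<And>z. norm (H z) \<le> B"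
      using Tietze[of K "h \<circ> \<pi>" UNIV B] Kcl B by auto
    have Hm: "H \<in> borel_measurable borel" by (rule borel_measurable_continuous_onI[OF H(1)])
    have "(\<lambda>n. integral\<^sup>L ((emp \<circ> s \<circ> r) n) H) \<longlonglongrightarrow> integral\<^sup>L M H"
      by (rule weak_conv_imp_integral_bdd_continuous_conv[OF _ r(2,3) _ H(3)])
         (use emp H(1) in \<open>auto simp: continuous_on_eq_continuous_at\<close>)
    moreover have "integral\<^sup>L (emp n) H = avg h n" for n
      unfolding emp_def empirical_integral[OF Hm] avg_def using H(2)[OF cK] \<pi>[OF yE] by simp
    moreover have "integral\<^sup>L \<nu> h = integral\<^sup>L M H"
      unfolding \<nu>_def integral_distr[OF \<pi>'m hm]
    proof (rule integral_cong_AE)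
      show "AE z in M. h (\<pi>' z) = H z" using MK by eventually_elim (simp add: H(2) \<pi>'_def)
      show "(\<lambda>z. h (\<pi>' z)) \<in> borel_measurable M" by (rule measurable_compose[OF \<pi>'m hm])
    qed (use Hm in simp)
    ultimately show ?thesis by simp
  qed
  have sr: "strict_mono (s \<circ> r)" using e(2) r(1) by (rule strict_mono_o)
  have inv: "(\<integral>y. h (T y) \<partial>\<nu>) = integral\<^sup>L \<nu> h" if h: "continuous_on E h" for h :: "'a \<Rightarrow> real"
  proof -
    have hT: "continuous_on E (\<lambda>y. h (T y))"
      using T h by (intro continuous_on_compose2[OF h]) auto
    obtain B where B: "\<And>z. z \<in> E \<Longrightarrow> \<bar>h z\<bar> \<le> B"
      using compact_imp_bounded[OF compact_continuous_image[OF h E]] unfolding bounded_iff by auto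
    \<comment> \<open>Shifting the orbit by one step changes the sum only at its two ends, so every
      limit point of the empirical measures is T-invariant.\<close>
    have diff: "avg (\<lambda>y. h (T y)) n - avg h n = (h (y (Suc (Suc n))) - h (y 1)) / real (Suc n)" for n
    proof -
      have "(\<Sum>k=1..Suc n. h (T (y k))) = (\<Sum>k=1..Suc n. h (y (Suc k)))" by (simp add: y_def)
      then show ?thesis
        using sum_Suc_diff[of 1 "Suc n" "\<lambda>k. h (y k)"]
        by (simp only: avg_def diff_divide_distrib[symmetric] sum_subtractf[symmetric])
    qed
    have "(\<lambda>n. avg (\<lambda>y. h (T y)) n - avg h n) \<longlonglongrightarrow> 0"
    proof (rule Lim_null_comparison)
      show "eventually (\<lambda>n. norm (avg (\<lambda>y. h (T y)) n - avg h n) \<le> (2 * B) * inverse (real (Suc n))) sequentially"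
      proof (rule always_eventually, rule allI)
        fix n
        have "\<bar>h (y (Suc (Suc n))) - h (y 1)\<bar> \<le> 2 * B"
          using B[OF yE, of "Suc (Suc n)"] B[OF yE, of 1] by linarith
        then show "norm (avg (\<lambda>y. h (T y)) n - avg h n) \<le> (2 * B) * inverse (real (Suc n))"
          unfolding diff by (simp add: divide_inverse abs_mult mult_right_mono)
      qed
      show "(\<lambda>n. 2 * B * inverse (real (Suc n))) \<longlonglongrightarrow> 0"
        using tendsto_mult_right_zero[OF LIMSEQ_inverse_real_of_nat] .
    qed
    then have "(\<lambda>n. avg (\<lambda>y. h (T y)) (s (r n)) - avg h (s (r n))) \<longlonglongrightarrow> 0"
      using LIMSEQ_subseq_LIMSEQ[OF _ sr] by (auto simp: o_def)
    moreover have "(\<lambda>n. avg (\<lambda>y. h (T y)) (s (r n)) - avg h (s (r n))) \<longlonglongrightarrow> (\<integral>y. h (T y) \<partial>\<nu>) - integral\<^sup>L \<nu> h"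
      by (intro tendsto_diff conv h hT)
    ultimately show ?thesis using LIMSEQ_unique by fastforce
  qed
  have "T \<in> restrict_space borel E \<rightarrow>\<^sub>M restrict_space borel E"
    using T by (intro measurable_restrict_space2 borel_measurable_continuous_on_restrict)
      (auto simp: space_restrict_space)
  then have Tm: "T \<in> \<nu> \<rightarrow>\<^sub>M restrict_space borel E"
    by (simp add: measurable_cong_sets[OF \<nu>(2) refl])
  have "distr \<nu> (restrict_space borel E) T = \<nu>"
  proof (rule measure_eqI_continuous_integrals[OF compact_imp_closed[OF E]])
    interpret \<nu>: prob_space \<nu> by (rule \<nu>(1))
    show "prob_space (distr \<nu> (restrict_space borel E) T)" using Tm by (rule \<nu>.prob_space_distr)
    fix h :: "'a \<Rightarrow> real" assume h: "continuous_on E h"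
    show "integral\<^sup>L (distr \<nu> (restrict_space borel E) T) h = integral\<^sup>L \<nu> h"
      unfolding integral_distr[OF Tm borel_measurable_continuous_on_restrict[OF h]] by (rule inv[OF h])
  qed (use \<nu> in simp_all)
  then have "\<nu> = \<mu>"
    using erg \<nu> unfolding uniquely_ergodic_def invariant_prob_def by blast
  then have "(\<lambda>n. \<bar>avg g (s (r n)) - integral\<^sup>L \<mu> g\<bar>) \<longlonglongrightarrow> 0"
    using conv[OF g] by (intro tendsto_rabs_zero) (simp add: LIM_zero)
  then have "e \<le> 0" using e(3) by (intro LIMSEQ_le_const[of _ 0]) auto
  then show False using e(1) by simp
qed

section \<open>Hubbard--Stratonovich transformation\<close>

text \<open>The substitution s = X + y / sqrt b reduces both claims to the standard normal law and
  its characteristic function.\<close>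

lemma gaussian_fourier:
  fixes b t X :: real
  assumes b: "b > 0"
  shows "integrable lborel (\<lambda>s. iexp (t * s) * complex_of_real (exp (- (b / 2) * (s - X)\<^sup>2)))" (is "integrable _ ?f")
    and "(LBINT s. iexp (t * s) * complex_of_real (exp (- (b / 2) * (s - X)\<^sup>2)))
      = complex_of_real (sqrt (2 * pi / b)) * iexp (t * X) * complex_of_real (exp (- t\<^sup>2 / (2 * b)))"
proof -
  define c where "c = 1 / sqrt b"
  have c: "c \<noteq> 0" "c > 0" "b * c\<^sup>2 = 1" using b by (auto simp: c_def power_divide)
  have eq: "?f (X + c * y) = (complex_of_real (sqrt (2 * pi)) * iexp (t * X)) *
      (std_normal_density y *\<^sub>R iexp ((t * c) * y))" for y
  proof -
    have "(b / 2) * (c * y)\<^sup>2 = y\<^sup>2 / 2"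
      using c(3) by (simp add: power_mult_distrib)
    then have "exp (- (b / 2) * (X + c * y - X)\<^sup>2) = sqrt (2 * pi) * std_normal_density y"
      by (simp add: std_normal_density_def)
    moreover have "iexp (t * (X + c * y)) = iexp (t * X) * iexp (t * c * y)"
      by (simp add: exp_add[symmetric] algebra_simps)
    ultimately show ?thesis by (simp add: scaleR_conv_of_real)
  qed
  have int: "integrable lborel (\<lambda>y. std_normal_density y *\<^sub>R iexp ((t * c) * y))"
    by (rule integrable_norm_iff[THEN iffD1]) (simp_all add: integrable_normal_density)
  have "integrable lborel (\<lambda>y. ?f (X + c * y))" unfolding eq by (intro integrable_mult_right int)
  then show "integrable lborel ?f" using lborel_integrable_real_affine_iff[OF c(1), of ?f X] by simp
  have "(LBINT s. ?f s) = c *\<^sub>R (LBINT y. ?f (X + c * y))"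
    using lborel_integral_real_affine[OF c(1), of ?f X] c(2) by simp
  also have "(LBINT y. ?f (X + c * y)) = complex_of_real (sqrt (2 * pi)) * iexp (t * X) *
      (LBINT y. std_normal_density y *\<^sub>R iexp ((t * c) * y))"
    unfolding eq by (rule integral_mult_right_zero)
  also have "(LBINT y. std_normal_density y *\<^sub>R iexp ((t * c) * y)) = char std_normal_distribution (t * c)"
    unfolding char_def by (subst integral_density) (auto simp: normal_density_nonneg)
  also have "\<dots> = complex_of_real (exp (- t\<^sup>2 / (2 * b)))"
    using b by (simp add: char_std_normal_distribution c_def power_divide power_mult_distrib field_simps)
  finally show "(LBINT s. ?f s) = complex_of_real (sqrt (2 * pi / b)) * iexp (t * X) * complex_of_real (exp (- t\<^sup>2 / (2 * b)))"
    by (simp add: c_def real_sqrt_divide scaleR_conv_of_real)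
qed

section \<open>The Gibbs measure and its characteristic function\<close>

lemma finite_configs: "finite (configs n)"
  unfolding configs_def by (intro finite_PiE) auto

text \<open>\<open>exp (L p u)\<close> is the moment generating function of a single spin. Expanding
  the product over the sites gives that of the magnetization under independent spins.\<close>

lemma exp_sum_L:
  assumes p: "\<And>i. p i \<in> {0..1}"
  shows "exp (\<Sum>i=1..n. L (p i) u) =
    (\<Sum>\<sigma>\<in>configs n. (\<Prod>i=1..n. spin_prob (p i) (\<sigma> i)) * exp (u * magnetization n \<sigma>))"
proof -
  have "exp (\<Sum>i=1..n. L (p i) u) = (\<Prod>i=1..n. \<Sum>s\<in>{-1,1}. spin_prob (p i) s * exp (u * s))"
    by (simp add: exp_sum exp_L[OF p] spin_prob_def add.commute)
  also have "\<dots> = (\<Sum>\<sigma>\<in>configs n. \<Prod>i=1..n. spin_prob (p i) (\<sigma> i) * exp (u * \<sigma> i))"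
    unfolding configs_def by (rule prod_sum_PiE) auto
  also have "\<dots> = (\<Sum>\<sigma>\<in>configs n. (\<Prod>i=1..n. spin_prob (p i) (\<sigma> i)) * exp (u * magnetization n \<sigma>))"
    by (simp add: prod.distrib magnetization_def sum_distrib_left exp_sum)
  finally show ?thesis .
qed

context
  fixes \<beta> J :: real and f :: "'a \<Rightarrow> real" and T :: "'a \<Rightarrow> 'a" and x :: 'a
  assumes pos: "\<beta> > 0" "J > 0"
    and p: "\<And>i. f ((T ^^ i) x) \<in> {0..1}"
begin

lemma gibbs_weight_nonneg: "gibbs_weight \<beta> J f T n x \<sigma> \<ge> 0"
  using p unfolding gibbs_weight_def spin_prob_def
  by (intro mult_nonneg_nonneg prod_nonneg) auto

text \<open>The weights of independent spins sum to 1 (\<open>exp_sum_L\<close> at 0) and the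
  interaction factor is at least 1. So the normalization is sound even when f takes the values 0 or
  1 and single weights vanish.\<close>

lemma gibbs_weight_sum_pos: "(\<Sum>\<sigma>\<in>configs n. gibbs_weight \<beta> J f T n x \<sigma>) > 0"
proof -
  have "(1::real) = exp (\<Sum>i=1..n. L (f ((T ^^ i) x)) 0)" by (simp add: L_def)
  also have "\<dots> = (\<Sum>\<sigma>\<in>configs n. \<Prod>i=1..n. spin_prob (f ((T ^^ i) x)) (\<sigma> i))"
    by (subst exp_sum_L[OF p]) simp
  also have "\<dots> \<le> (\<Sum>\<sigma>\<in>configs n. gibbs_weight \<beta> J f T n x \<sigma>)"
  proof (rule sum_mono)
    fix \<sigma>
    have "1 * (\<Prod>i=1..n. spin_prob (f ((T ^^ i) x)) (\<sigma> i)) \<le> gibbs_weight \<beta> J f T n x \<sigma>"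
      using p pos unfolding gibbs_weight_def spin_prob_def
      by (intro mult_right_mono prod_nonneg) auto
    then show "(\<Prod>i=1..n. spin_prob (f ((T ^^ i) x)) (\<sigma> i)) \<le> gibbs_weight \<beta> J f T n x \<sigma>" by simp
  qed
  finally show ?thesis by linarith
qed

lemma integral_gibbs:
  fixes h :: "(nat \<Rightarrow> real) \<Rightarrow> 'b::{banach, second_countable_topology}"
  shows "integral\<^sup>L (gibbs \<beta> J f T n x) h =
    (\<Sum>\<sigma>\<in>configs n. (gibbs_weight \<beta> J f T n x \<sigma> / (\<Sum>\<tau>\<in>configs n. gibbs_weight \<beta> J f T n x \<tau>)) *\<^sub>R h \<sigma>)"
  unfolding gibbs_def
  using gibbs_weight_nonneg gibbs_weight_sum_pos[of n] finite_configs
  by (intro lebesgue_integral_point_measure_finite) (auto intro!: divide_nonneg_pos)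

lemma prob_space_gibbs: "prob_space (gibbs \<beta> J f T n x)"
  unfolding gibbs_def
proof (rule prob_space_point_measure)
  show "(\<Sum>\<sigma>\<in>configs n. ennreal (gibbs_weight \<beta> J f T n x \<sigma> / (\<Sum>\<tau>\<in>configs n. gibbs_weight \<beta> J f T n x \<tau>))) = 1"
    using gibbs_weight_nonneg gibbs_weight_sum_pos[of n]
    by (subst sum_ennreal) (auto simp: sum_divide_distrib[symmetric] intro!: divide_nonneg_pos)
qed (auto simp: finite_configs)

lemma measurable_gibbs: "h \<in> gibbs \<beta> J f T n x \<rightarrow>\<^sub>M borel"
  unfolding gibbs_def by (simp add: measurable_point_measure_eq1)

lemma real_distribution_gibbs: "real_distribution (distr (gibbs \<beta> J f T n x) borel h)"
proof -
  interpret prob_space "gibbs \<beta> J f T n x" by (rule prob_space_gibbs)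
  show ?thesis by (rule real_distribution_distr[OF measurable_gibbs])
qed

lemma char_gibbs:
  "char (distr (gibbs \<beta> J f T n x) borel h) t =
    (\<Sum>\<sigma>\<in>configs n. gibbs_weight \<beta> J f T n x \<sigma> * iexp (t * h \<sigma>)) / (\<Sum>\<tau>\<in>configs n. gibbs_weight \<beta> J f T n x \<tau>)"
  unfolding char_def
  by (subst integral_distr[OF measurable_gibbs])
     (auto simp: integral_gibbs scaleR_conv_of_real sum_divide_distrib)

text \<open>The Hubbard--Stratonovich transformation: adding an independent Gaussian to the
  magnetization linearizes the quadratic interaction.\<close>

lemma hubbard_stratonovich:
  assumes n: "n > 0"
  shows "exp (- real n * (\<beta> * J / 2 * v\<^sup>2 - (\<Sum>i=1..n. L (f ((T ^^ i) x)) (\<beta> * J * v)) / real n)) =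
    (\<Sum>\<sigma>\<in>configs n. gibbs_weight \<beta> J f T n x \<sigma> *
       exp (- (real n * (\<beta> * J) / 2) * (v - magnetization n \<sigma> / real n)\<^sup>2))"
proof -
  have "- real n * (\<beta> * J) / 2 * v\<^sup>2 + \<beta> * J * v * M =
      \<beta> * J / (2 * real n) * M\<^sup>2 + - (real n * (\<beta> * J) / 2) * (v - M / real n)\<^sup>2" for M
    using n by (simp add: power2_eq_square field_simps)
  then have complete_square: "exp (- real n * (\<beta> * J) / 2 * v\<^sup>2) * exp (\<beta> * J * v * M) =
      exp (\<beta> * J / (2 * real n) * M\<^sup>2) * exp (- (real n * (\<beta> * J) / 2) * (v - M / real n)\<^sup>2)" for M
    by (simp only: exp_add[symmetric])
  have "exp (- real n * (\<beta> * J / 2 * v\<^sup>2 - (\<Sum>i=1..n. L (f ((T ^^ i) x)) (\<beta> * J * v)) / real n)) =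
    exp (- real n * (\<beta> * J) / 2 * v\<^sup>2) * exp (\<Sum>i=1..n. L (f ((T ^^ i) x)) (\<beta> * J * v))"
    using n by (simp add: exp_add[symmetric] field_simps)
  also have "\<dots> = (\<Sum>\<sigma>\<in>configs n. (\<Prod>i=1..n. spin_prob (f ((T ^^ i) x)) (\<sigma> i)) *
      (exp (- real n * (\<beta> * J) / 2 * v\<^sup>2) * exp (\<beta> * J * v * magnetization n \<sigma>)))"
    by (simp only: exp_sum_L[OF p] sum_distrib_left mult.left_commute)
  also have "\<dots> = (\<Sum>\<sigma>\<in>configs n. (\<Prod>i=1..n. spin_prob (f ((T ^^ i) x)) (\<sigma> i)) *
      (exp (\<beta> * J / (2 * real n) * (magnetization n \<sigma>)\<^sup>2) *
       exp (- (real n * (\<beta> * J) / 2) * (v - magnetization n \<sigma> / real n)\<^sup>2)))"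
    by (simp only: complete_square)
  finally show ?thesis by (simp add: gibbs_weight_def ac_simps)
qed

text \<open>Both sides are the characteristic function of the rescaled magnetization plus an
  independent centred Gaussian of variance 1 / (n c^2 \<beta>J): on the left as a product, on the
  right through its unnormalized density. The sum over configurations is a mixture of Gaussians, and
  its common prefactor cancels in the ratio.\<close>

lemma char_gibbs_eq_fourier:
  fixes m c :: real and n :: nat
  defines "\<Phi> \<equiv> \<lambda>t. LBINT s. iexp (t * s) * complex_of_real (exp (- real n *
      (\<beta> * J / 2 * (m + c * s)\<^sup>2 - (\<Sum>i=1..n. L (f ((T ^^ i) x)) (\<beta> * J * (m + c * s))) / real n)))"
  assumes n: "n > 0" and c: "c > 0"
  shows "char (distr (gibbs \<beta> J f T n x) borel
      (\<lambda>\<sigma>. (magnetization n \<sigma> - real n * m) / (real n * c))) t *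
    complex_of_real (exp (- t\<^sup>2 / (2 * (real n * c\<^sup>2 * (\<beta> * J))))) = \<Phi> t / \<Phi> 0"
proof -
  define w where "w = gibbs_weight \<beta> J f T n x"
  define X where "X \<sigma> = (magnetization n \<sigma> - real n * m) / (real n * c)" for \<sigma>
  define b where "b = real n * c\<^sup>2 * (\<beta> * J)"
  have b: "b > 0" using n c pos by (simp add: b_def)
  have sq: "- (real n * (\<beta> * J) / 2) * (m + c * s - magnetization n \<sigma> / real n)\<^sup>2 = - (b / 2) * (s - X \<sigma>)\<^sup>2" for s \<sigma>
  proof -
    have "m + c * s - magnetization n \<sigma> / real n = c * (s - X \<sigma>)"
      using n c by (simp add: X_def field_simps)
    then show ?thesis by (simp add: b_def power_mult_distrib)
  qed
  have "\<Phi> t = (LBINT s. \<Sum>\<sigma>\<in>configs n. complex_of_real (w \<sigma>) *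
      (iexp (t * s) * complex_of_real (exp (- (b / 2) * (s - X \<sigma>)\<^sup>2))))" for t
    unfolding \<Phi>_def hubbard_stratonovich[OF n] sq w_def[symmetric]
    by (simp add: sum_distrib_left ac_simps)
  also have "\<dots> t = (\<Sum>\<sigma>\<in>configs n. complex_of_real (w \<sigma>) *
      (complex_of_real (sqrt (2 * pi / b)) * iexp (t * X \<sigma>) * complex_of_real (exp (- t\<^sup>2 / (2 * b)))))" for t
    by (subst Bochner_Integration.integral_sum)
       (simp_all only: integral_mult_right_zero gaussian_fourier[OF b] integrable_mult_right)
  finally have \<Phi>: "\<Phi> t = complex_of_real (sqrt (2 * pi / b)) * complex_of_real (exp (- t\<^sup>2 / (2 * b))) *
      (\<Sum>\<sigma>\<in>configs n. complex_of_real (w \<sigma>) * iexp (t * X \<sigma>))" for t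
    by (simp add: sum_distrib_left ac_simps)
  have W: "(\<Sum>\<sigma>\<in>configs n. w \<sigma>) \<noteq> 0" using gibbs_weight_sum_pos[of n] by (simp add: w_def)
  have "sqrt (2 * pi / b) \<noteq> 0" using b by simp
  then have "\<Phi> t / \<Phi> 0 = complex_of_real (exp (- t\<^sup>2 / (2 * b))) *
      (\<Sum>\<sigma>\<in>configs n. complex_of_real (w \<sigma>) * iexp (t * X \<sigma>)) / complex_of_real (\<Sum>\<sigma>\<in>configs n. w \<sigma>)"
    using W unfolding \<Phi>[of t] \<Phi>[of 0] by simp
  then show ?thesis
    unfolding char_gibbs w_def[symmetric] X_def[symmetric] b_def[symmetric] by (simp add: mult.commute)
qed

end

section \<open>The potential and its growth\<close>

definition quad_deriv :: "real \<Rightarrow> nat \<Rightarrow> real \<Rightarrow> real" where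
  "quad_deriv a j s = (if j = 0 then a / 2 * s\<^sup>2 else if j = 1 then a * s else if j = 2 then a else 0)"

text \<open>The index j counts derivatives in s, each bringing a factor a by the chain rule. The
  measure is left free: \<open>\<mu>\<close> with \<open>f\<close> gives G, and the uniform measure
  on {1..n} with f along the orbit gives G_n.\<close>

definition potential :: "real \<Rightarrow> 'b measure \<Rightarrow> ('b \<Rightarrow> real) \<Rightarrow> nat \<Rightarrow> real \<Rightarrow> real" where
  "potential a M \<phi> j s = quad_deriv a j s - a ^ j * (\<integral>y. L_deriv j (\<phi> y) (a * s) \<partial>M)"

lemma DERIV_quad_deriv: "(quad_deriv a j has_real_derivative quad_deriv a (Suc j) s) (at s)"
proof -
  consider "j = 0" | "j = 1" | "j \<ge> 2" by linarith
  then show ?thesis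
  proof cases
    case 3
    then have "quad_deriv a j = (\<lambda>_. if j = 2 then a else 0)" by (simp add: quad_deriv_def fun_eq_iff)
    then show ?thesis using 3 by (simp add: quad_deriv_def)
  qed (auto simp: quad_deriv_def[abs_def] intro!: derivative_eq_intros)
qed

text \<open>The mean value inequality bounds the difference quotients by B, and constants are
  integrable for a finite measure, so dominated convergence applies.\<close>

lemma (in finite_measure) DERIV_integral_parameter:
  fixes h h' :: "'a \<Rightarrow> real \<Rightarrow> real"
  assumes der: "\<And>y s. y \<in> space M \<Longrightarrow> (h y has_real_derivative h' y s) (at s)"
    and bd: "\<And>y s. y \<in> space M \<Longrightarrow> \<bar>h' y s\<bar> \<le> B"
    and int: "\<And>s. integrable M (\<lambda>y. h y s)"
    and [measurable]: "(\<lambda>y. h' y s) \<in> borel_measurable M"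
  shows "((\<lambda>s. \<integral>y. h y s \<partial>M) has_real_derivative (\<integral>y. h' y s \<partial>M)) (at s)"
  unfolding DERIV_def tendsto_at_iff_sequentially
proof (intro allI impI)
  fix X :: "nat \<Rightarrow> real" assume X: "\<forall>i. X i \<in> UNIV - {0}" "X \<longlonglongrightarrow> 0"
  have [measurable]: "(\<lambda>y. h y s) \<in> borel_measurable M" for s using int by auto
  have "(\<lambda>i. \<integral>y. (h y (s + X i) - h y s) / X i \<partial>M) \<longlonglongrightarrow> (\<integral>y. h' y s \<partial>M)"
  proof (rule integral_dominated_convergence[where w = "\<lambda>_. B"])
    show "AE y in M. (\<lambda>i. (h y (s + X i) - h y s) / X i) \<longlonglongrightarrow> h' y s"
    proof (rule AE_I2)
      fix y assume y: "y \<in> space M"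
      show "(\<lambda>i. (h y (s + X i) - h y s) / X i) \<longlonglongrightarrow> h' y s"
        using der[OF y, of s] X unfolding DERIV_def tendsto_at_iff_sequentially by (auto simp: o_def)
    qed
    show "AE y in M. norm ((h y (s + X i) - h y s) / X i) \<le> B" for i
    proof (rule AE_I2)
      fix y assume y: "y \<in> space M"
      have "norm (h y (s + X i) - h y s) \<le> B * norm (s + X i - s)"
        by (rule field_differentiable_bound[of UNIV "h y" "h' y"])
           (use der[OF y] bd[OF y] in \<open>auto intro: has_field_derivative_at_within\<close>)
      then show "norm ((h y (s + X i) - h y s) / X i) \<le> B"
        using X(1) by (simp add: divide_le_eq)
    qed
  qed auto
  moreover have "(\<integral>y. (h y (s + X i) - h y s) / X i \<partial>M) =
      ((\<integral>y. h y (s + X i) \<partial>M) - (\<integral>y. h y s \<partial>M)) / X i" for i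
    using int by simp
  ultimately show "((\<lambda>h'. ((\<integral>y. h y (s + h') \<partial>M) - (\<integral>y. h y s \<partial>M)) / h') \<circ> X) \<longlonglongrightarrow> (\<integral>y. h' y s \<partial>M)"
    by (simp only: o_def)
qed

context prob_space
begin

context
  fixes \<phi> :: "'a \<Rightarrow> real" and a :: real
  assumes \<phi> [measurable]: "\<phi> \<in> borel_measurable M" and \<phi>_in: "\<And>y. y \<in> space M \<Longrightarrow> \<phi> y \<in> {0..1}"
    and a: "a > 0"
begin

lemma integrable_L_deriv: "integrable M (\<lambda>y. L_deriv j (\<phi> y) s)"
proof -
  have "\<exists>B. \<forall>\<phi>\<in>{0..1}. \<bar>L_deriv j \<phi> s\<bar> \<le> B"
  proof (cases j)
    case 0
    then show ?thesis using abs_L_le by (intro exI[of _ "\<bar>s\<bar>"]) simp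
  next
    case (Suc i)
    then show ?thesis using L_deriv_bounded[of i] by blast
  qed
  then obtain B where "\<And>y. y \<in> space M \<Longrightarrow> \<bar>L_deriv j (\<phi> y) s\<bar> \<le> B" using \<phi>_in by blast
  then show ?thesis by (intro integrable_const_bound[where B = B]) auto
qed

lemma abs_integral_le:
  assumes "\<And>y. y \<in> space M \<Longrightarrow> \<bar>h y\<bar> \<le> B" "integrable M h"
  shows "\<bar>\<integral>y. h y \<partial>M\<bar> \<le> (B::real)"
proof -
  have "\<bar>\<integral>y. h y \<partial>M\<bar> \<le> (\<integral>y. \<bar>h y\<bar> \<partial>M)" by (rule integral_abs_bound)
  also have "\<dots> \<le> (\<integral>y. B \<partial>M)" using assms by (intro integral_mono) auto
  finally show ?thesis by (simp add: prob_space)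
qed

lemma DERIV_potential:
  "(potential a M \<phi> j has_real_derivative potential a M \<phi> (Suc j) s) (at s)"
proof -
  obtain B where B: "B > 0" "\<forall>\<phi>\<in>{0..1}. \<forall>s. \<bar>L_deriv (Suc j) \<phi> s\<bar> \<le> B"
    using L_deriv_bounded by blast
  have "((\<lambda>s. \<integral>y. L_deriv j (\<phi> y) (a * s) \<partial>M) has_real_derivative
      (\<integral>y. a * L_deriv (Suc j) (\<phi> y) (a * s) \<partial>M)) (at s)"
  proof (rule DERIV_integral_parameter[where B = "a * B"])
    show "((\<lambda>s. L_deriv j (\<phi> y) (a * s)) has_real_derivative a * L_deriv (Suc j) (\<phi> y) (a * s)) (at s)"
      if "y \<in> space M" for y s
      using DERIV_chain2[OF DERIV_L_deriv[OF \<phi>_in[OF that]] DERIV_cmult_Id[of a s UNIV]]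
      by (simp only: mult.commute)
    show "\<bar>a * L_deriv (Suc j) (\<phi> y) (a * s)\<bar> \<le> a * B" if "y \<in> space M" for y s
      using a B(2) \<phi>_in[OF that] by (auto simp: abs_mult intro: mult_left_mono)
    show "(\<lambda>y. a * L_deriv (Suc j) (\<phi> y) (a * s)) \<in> borel_measurable M" by measurable
  qed (rule integrable_L_deriv)
  then have "((\<lambda>s. quad_deriv a j s - a ^ j * (\<integral>y. L_deriv j (\<phi> y) (a * s) \<partial>M)) has_real_derivative
      quad_deriv a (Suc j) s - a ^ j * (\<integral>y. a * L_deriv (Suc j) (\<phi> y) (a * s) \<partial>M)) (at s)"
    by (intro DERIV_diff DERIV_quad_deriv DERIV_cmult)
  then show ?thesis by (simp add: potential_def[abs_def] mult_ac del: L_deriv_simps)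
qed

lemma iterated_deriv_potential: "(deriv ^^ j) (potential a M \<phi> 0) = potential a M \<phi> j"
  using iterated_deriv_eqI[of "potential a M \<phi>"] DERIV_potential by blast

text \<open>Since r + 1 \<ge> 3, the quadratic part does not contribute to the derivative in the
  remainder. What is left is bounded by B times a power of a, for every h and with a constant
  independent of the measure.\<close>

lemma potential_taylor:
  assumes B: "\<And>\<phi> s. \<phi> \<in> {0..1} \<Longrightarrow> \<bar>L_deriv (Suc r) \<phi> s\<bar> \<le> B" and r: "r \<ge> 2"
  shows "\<bar>potential a M \<phi> 0 (m + h) - potential a M \<phi> 0 m
    - (\<Sum>j=1..r. potential a M \<phi> j m / fact j * h ^ j)\<bar> \<le> a ^ Suc r * B * \<bar>h\<bar> ^ Suc r"
proof -
  let ?P = "potential a M \<phi>"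
  have "\<forall>j s. ((\<lambda>h. ?P j (m + h)) has_real_derivative ?P (Suc j) (m + s)) (at s)"
    using iffD1[OF DERIV_shift DERIV_potential] by (simp only: add.commute[of m] simp_thms)
  then obtain t where t: "?P 0 (m + h) = (\<Sum>j<Suc r. ?P j (m + 0) / fact j * h ^ j)
      + ?P (Suc r) (m + t) / fact (Suc r) * h ^ Suc r"
    using Maclaurin_all_le[of "\<lambda>j h. ?P j (m + h)" "\<lambda>h. ?P 0 (m + h)" h "Suc r"] by blast
  have "(\<Sum>j<Suc r. ?P j m / fact j * h ^ j) = ?P 0 m + (\<Sum>j=1..r. ?P j m / fact j * h ^ j)"
    by (simp only: lessThan_Suc_atMost atMost_atLeast0 sum.atLeast_Suc_atMost[OF le0]) simp
  then have eq: "?P 0 (m + h) - ?P 0 m - (\<Sum>j=1..r. ?P j m / fact j * h ^ j)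
      = ?P (Suc r) (m + t) / fact (Suc r) * h ^ Suc r"
    using t by simp
  have "\<bar>?P (Suc r) (m + t)\<bar> = a ^ Suc r * \<bar>\<integral>y. L_deriv (Suc r) (\<phi> y) (a * (m + t)) \<partial>M\<bar>"
    using r a by (simp add: potential_def quad_deriv_def abs_mult del: L_deriv_simps)
  also have "\<dots> \<le> a ^ Suc r * B"
    using a B \<phi>_in by (intro mult_left_mono abs_integral_le integrable_L_deriv) auto
  finally have P: "\<bar>?P (Suc r) (m + t)\<bar> \<le> a ^ Suc r * B" .
  have "\<bar>?P (Suc r) (m + t) / fact (Suc r)\<bar> \<le> \<bar>?P (Suc r) (m + t)\<bar> / 1"
    unfolding abs_divide by (rule divide_left_mono) (simp_all add: fact_ge_1 del: fact_Suc)
  then have "\<bar>?P (Suc r) (m + t) / fact (Suc r)\<bar> \<le> a ^ Suc r * B" using P by linarith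
  then show ?thesis unfolding eq abs_mult power_abs by (rule mult_right_mono) simp
qed

text \<open>By \<open>abs_L_le\<close> the integral is at most linear in s, so the quadratic term
  gives coercivity at a rate common to all measures.\<close>

lemma potential_bounds:
  "a / 2 * s\<^sup>2 - a * \<bar>s\<bar> \<le> potential a M \<phi> 0 s" "potential a M \<phi> 0 s \<le> a / 2 * s\<^sup>2 + a * \<bar>s\<bar>"
proof -
  have "\<bar>\<integral>y. L_deriv 0 (\<phi> y) (a * s) \<partial>M\<bar> \<le> a * \<bar>s\<bar>"
  proof (rule abs_integral_le[OF _ integrable_L_deriv])
    fix y assume "y \<in> space M"
    then show "\<bar>L_deriv 0 (\<phi> y) (a * s)\<bar> \<le> a * \<bar>s\<bar>"
      using abs_L_le[OF \<phi>_in, of y "a * s"] a by (simp add: abs_mult)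
  qed
  then show "a / 2 * s\<^sup>2 - a * \<bar>s\<bar> \<le> potential a M \<phi> 0 s" "potential a M \<phi> 0 s \<le> a / 2 * s\<^sup>2 + a * \<bar>s\<bar>"
    by (auto simp: potential_def quad_deriv_def)
qed

text \<open>The term 1 comes from the Lipschitz bound on L, the terms in |s| and |t| from the
  square. It supplies equicontinuity in n on bounded sets.\<close>

lemma potential_local_lipschitz:
  "\<bar>potential a M \<phi> 0 s - potential a M \<phi> 0 t\<bar> \<le> a * (1 + \<bar>s\<bar> + \<bar>t\<bar>) * \<bar>s - t\<bar>"
proof -
  have "\<bar>\<integral>y. L_deriv 0 (\<phi> y) (a * s) - L_deriv 0 (\<phi> y) (a * t) \<partial>M\<bar> \<le> a * \<bar>s - t\<bar>"
  proof (rule abs_integral_le[OF _ Bochner_Integration.integrable_diff[OF integrable_L_deriv integrable_L_deriv]])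
    fix y assume y: "y \<in> space M"
    have "\<bar>L (\<phi> y) (a * s) - L (\<phi> y) (a * t)\<bar> \<le> \<bar>a * s - a * t\<bar>" by (rule L_lipschitz[OF \<phi>_in[OF y]])
    also have "\<dots> = a * \<bar>s - t\<bar>" using a by (simp add: abs_mult right_diff_distrib[symmetric])
    finally show "\<bar>L_deriv 0 (\<phi> y) (a * s) - L_deriv 0 (\<phi> y) (a * t)\<bar> \<le> a * \<bar>s - t\<bar>" by simp
  qed
  then have 1: "\<bar>(\<integral>y. L (\<phi> y) (a * s) \<partial>M) - (\<integral>y. L (\<phi> y) (a * t) \<partial>M)\<bar> \<le> a * \<bar>s - t\<bar>"
    using integrable_L_deriv[of 0] by simp
  \<comment> \<open>The factor 2 is slack that absorbs the 1/2 of a/2.\<close>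
  have "\<bar>s + t\<bar> * \<bar>s - t\<bar> \<le> 2 * (\<bar>s\<bar> + \<bar>t\<bar>) * \<bar>s - t\<bar>"
    by (rule mult_right_mono) auto
  then have "a / 2 * (\<bar>s + t\<bar> * \<bar>s - t\<bar>) \<le> a / 2 * (2 * (\<bar>s\<bar> + \<bar>t\<bar>) * \<bar>s - t\<bar>)"
    using a by (intro mult_left_mono) auto
  moreover have "a / 2 * s\<^sup>2 - a / 2 * t\<^sup>2 = a / 2 * ((s + t) * (s - t))"
    by (simp add: power2_eq_square algebra_simps)
  then have "\<bar>a / 2 * s\<^sup>2 - a / 2 * t\<^sup>2\<bar> = a / 2 * (\<bar>s + t\<bar> * \<bar>s - t\<bar>)"
    using a by (simp only: abs_mult abs_divide abs_numeral abs_of_pos)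
  moreover have "a / 2 * (2 * (\<bar>s\<bar> + \<bar>t\<bar>) * \<bar>s - t\<bar>) = a * ((\<bar>s\<bar> + \<bar>t\<bar>) * \<bar>s - t\<bar>)" by simp
  ultimately have 2: "\<bar>a / 2 * s\<^sup>2 - a / 2 * t\<^sup>2\<bar> \<le> a * ((\<bar>s\<bar> + \<bar>t\<bar>) * \<bar>s - t\<bar>)" by argo
  have "\<bar>u - I - (v - I')\<bar> \<le> \<bar>u - v\<bar> + \<bar>I - I'\<bar>" for u v I I' :: real by linarith
  then have "\<bar>potential a M \<phi> 0 s - potential a M \<phi> 0 t\<bar> \<le> \<bar>a / 2 * s\<^sup>2 - a / 2 * t\<^sup>2\<bar> +
      \<bar>(\<integral>y. L (\<phi> y) (a * s) \<partial>M) - (\<integral>y. L (\<phi> y) (a * t) \<partial>M)\<bar>"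
    by (simp only: potential_def quad_deriv_def L_deriv_simps power_0 mult_1_left simp_thms if_True)
  also have "\<dots> \<le> a * ((\<bar>s\<bar> + \<bar>t\<bar>) * \<bar>s - t\<bar>) + a * \<bar>s - t\<bar>" by (rule add_mono[OF 2 1])
  also have "\<dots> = a * (1 + \<bar>s\<bar> + \<bar>t\<bar>) * \<bar>s - t\<bar>" by (simp add: algebra_simps)
  finally show ?thesis .
qed

end

end

text \<open>Coercivity handles large \<open>h\<close>; on the compact remainder, local equicontinuity upgrades
  pointwise convergence.\<close>

lemma uniform_quadratic_growth:
  fixes P :: "real \<Rightarrow> real" and Q :: "nat \<Rightarrow> real \<Rightarrow> real"
  assumes a: "a > 0" and \<delta>: "\<delta> > 0"
    and low: "\<And>n s. n \<ge> 1 \<Longrightarrow> a / 2 * s\<^sup>2 - a * \<bar>s\<bar> \<le> Q n s"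
    and up: "\<And>n s. n \<ge> 1 \<Longrightarrow> Q n s \<le> a / 2 * s\<^sup>2 + a * \<bar>s\<bar>"
    and lip: "\<And>n s t. n \<ge> 1 \<Longrightarrow> \<bar>Q n s - Q n t\<bar> \<le> a * (1 + \<bar>s\<bar> + \<bar>t\<bar>) * \<bar>s - t\<bar>"
    and conv: "\<And>s. (\<lambda>n. Q n s) \<longlonglongrightarrow> P s"
    and min: "\<And>s. s \<noteq> m \<Longrightarrow> P m < P s"
  shows "\<exists>\<epsilon>>0. eventually (\<lambda>n. \<forall>h. \<delta> \<le> \<bar>h\<bar> \<longrightarrow> \<epsilon> * h\<^sup>2 \<le> Q n (m + h) - Q n m) sequentially"
proof -
  \<comment> \<open>For |h| \<ge> R both (|m| + 1) |h| and 2 |m| are at most h^2/8, so the linear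
    terms consume at most half of h^2/2.\<close>
  define R where "R = 8 * (\<bar>m\<bar> + 1)"
  have R: "R > 0" by (simp add: R_def)
  have far: "a / 4 * h\<^sup>2 \<le> Q n (m + h) - Q n m" if "n \<ge> 1" "R \<le> \<bar>h\<bar>" for n h
  proof -
    have "8 * (\<bar>m\<bar> + 1) * \<bar>h\<bar> \<le> \<bar>h\<bar> * \<bar>h\<bar>" using that(2) unfolding R_def by (rule mult_right_mono) simp
    then have h1: "(\<bar>m\<bar> + 1) * \<bar>h\<bar> \<le> h\<^sup>2 / 8" by (simp add: power2_eq_square algebra_simps)
    have "2 * \<bar>m\<bar> \<le> \<bar>h\<bar>" using that(2) by (simp add: R_def)
    also have "\<bar>h\<bar> \<le> (\<bar>m\<bar> + 1) * \<bar>h\<bar>" by (simp add: algebra_simps)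
    finally have h2: "2 * \<bar>m\<bar> \<le> h\<^sup>2 / 8" using h1 by linarith
    have "- (m * h) \<le> \<bar>m\<bar> * \<bar>h\<bar>" using abs_ge_minus_self[of "m * h"] by (simp add: abs_mult)
    then have "h\<^sup>2 / 4 \<le> ((m + h)\<^sup>2 / 2 - \<bar>m + h\<bar>) - (m\<^sup>2 / 2 + \<bar>m\<bar>)"
      using h1 h2 abs_triangle_ineq[of m h] by (simp add: power2_sum algebra_simps)
    from mult_left_mono[OF this, of a] show ?thesis
      using a low[OF that(1), of "m + h"] up[OF that(1), of m] by (simp add: algebra_simps)
  qed
  define K where "K = {h. \<delta> \<le> \<bar>h\<bar> \<and> \<bar>h\<bar> \<le> R}"
  have "compact K"
  proof -
    have "K = {-R..-\<delta>} \<union> {\<delta>..R}" using \<delta> by (auto simp: K_def)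
    then show ?thesis by (simp add: compact_Un)
  qed
  have near: "\<exists>\<rho>>0. \<exists>\<epsilon>>0. eventually (\<lambda>n. \<forall>h\<in>K \<inter> ball z \<rho>. \<epsilon> * h\<^sup>2 \<le> Q n (m + h) - Q n m) sequentially"
    if z: "z \<in> K" for z
  proof -
    define \<eta> where "\<eta> = P (m + z) - P m"
    have \<eta>: "\<eta> > 0" using min[of "m + z"] z \<delta> by (auto simp: \<eta>_def K_def)
    \<comment> \<open>\<Lambda> is a Lipschitz constant on [-(|m| + R), |m| + R]. The radius \<rho>
      limits the change within the ball to \<eta>/4, so of the eventual 3\<eta>/4 at the centre
      \<eta>/2 remains; it is written as a multiple of h^2 by means of h^2 \<le> R^2.\<close>
    define \<Lambda> where "\<Lambda> = a * (1 + 2 * (\<bar>m\<bar> + R))"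
    have \<Lambda>: "\<Lambda> > 0" using a R by (auto simp: \<Lambda>_def intro!: mult_pos_pos add_pos_nonneg)
    define \<rho> where "\<rho> = \<eta> / 4 / \<Lambda>"
    have \<rho>: "\<rho> > 0" "\<Lambda> * \<rho> = \<eta> / 4" using \<eta> \<Lambda> by (auto simp: \<rho>_def)
    have "(\<lambda>n. Q n (m + z) - Q n m) \<longlonglongrightarrow> \<eta>" unfolding \<eta>_def by (intro tendsto_diff conv)
    then have "eventually (\<lambda>n. Q n (m + z) - Q n m > 3 / 4 * \<eta>) sequentially"
      using \<eta> by (intro order_tendstoD) auto
    then have "eventually (\<lambda>n. \<forall>h\<in>K \<inter> ball z \<rho>. \<eta> / (2 * R\<^sup>2) * h\<^sup>2 \<le> Q n (m + h) - Q n m) sequentially"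
      using eventually_ge_at_top[of "1::nat"]
    proof eventually_elim
      case (elim n)
      show ?case
      proof
        fix h assume h: "h \<in> K \<inter> ball z \<rho>"
        have "\<bar>Q n (m + h) - Q n (m + z)\<bar> \<le> a * (1 + \<bar>m + h\<bar> + \<bar>m + z\<bar>) * \<bar>(m + h) - (m + z)\<bar>"
          by (rule lip[OF elim(2)])
        also have "\<dots> \<le> \<Lambda> * \<rho>"
          unfolding \<Lambda>_def using h z a R by (intro mult_mono mult_left_mono) (auto simp: K_def dist_real_def)
        finally have "Q n (m + h) - Q n m \<ge> \<eta> / 2" using elim(1) \<rho>(2) by linarith
        moreover have "h\<^sup>2 \<le> R\<^sup>2" using h R by (intro power2_le_iff_abs_le[THEN iffD2]) (auto simp: K_def)
        then have "\<eta> / (2 * R\<^sup>2) * h\<^sup>2 \<le> \<eta> / (2 * R\<^sup>2) * R\<^sup>2" using \<eta> by (intro mult_left_mono) auto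
        ultimately show "\<eta> / (2 * R\<^sup>2) * h\<^sup>2 \<le> Q n (m + h) - Q n m" using R by simp
      qed
    qed
    then show ?thesis using \<rho>(1) \<eta> R by (intro exI[of _ \<rho>] conjI exI[of _ "\<eta> / (2 * R\<^sup>2)"]) auto
  qed
  then have "\<forall>z\<in>K. \<exists>p. fst p > 0 \<and> snd p > 0 \<and>
      eventually (\<lambda>n. \<forall>h\<in>K \<inter> ball z (fst p). snd p * h\<^sup>2 \<le> Q n (m + h) - Q n m) sequentially"
    by (simp only: split_paired_Ex fst_conv snd_conv) blast
  from bchoice[OF this] obtain p where
    p: "\<forall>z\<in>K. fst (p z) > 0 \<and> snd (p z) > 0 \<and>
      eventually (\<lambda>n. \<forall>h\<in>K \<inter> ball z (fst (p z)). snd (p z) * h\<^sup>2 \<le> Q n (m + h) - Q n m) sequentially"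
    by blast
  define \<rho> \<epsilon> where "\<rho> z = fst (p z)" and "\<epsilon> z = snd (p z)" for z
  have \<rho>: "\<And>z. z \<in> K \<Longrightarrow> \<rho> z > 0" and \<epsilon>: "\<And>z. z \<in> K \<Longrightarrow> \<epsilon> z > 0"
    and ev: "\<And>z. z \<in> K \<Longrightarrow> eventually (\<lambda>n. \<forall>h\<in>K \<inter> ball z (\<rho> z). \<epsilon> z * h\<^sup>2 \<le> Q n (m + h) - Q n m) sequentially"
    using p by (simp_all add: \<rho>_def \<epsilon>_def)
  obtain F where F: "F \<subseteq> K" "finite F" "K \<subseteq> (\<Union>z\<in>F. ball z (\<rho> z))"
    by (rule compactE_image[OF \<open>compact K\<close>, of K "\<lambda>z. ball z (\<rho> z)"]) (use \<rho> in auto)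
  \<comment> \<open>The entry a / 4 is the constant for |h| \<ge> R; it also keeps the set nonempty
    when F is empty.\<close>
  define e where "e = Min (insert (a / 4) (\<epsilon> ` F))"
  have e: "e > 0" unfolding e_def using F(1,2) a \<epsilon> by (subst Min_gr_iff) auto
  have e_le: "e \<le> a / 4" "\<And>z. z \<in> F \<Longrightarrow> e \<le> \<epsilon> z"
    unfolding e_def using F(2) by (intro Min_le; blast)+
  have "eventually (\<lambda>n. \<forall>z\<in>F. \<forall>h\<in>K \<inter> ball z (\<rho> z). \<epsilon> z * h\<^sup>2 \<le> Q n (m + h) - Q n m) sequentially"
    using F(1,2) ev by (intro eventually_ball_finite) auto
  then have "eventually (\<lambda>n. \<forall>h. \<delta> \<le> \<bar>h\<bar> \<longrightarrow> e * h\<^sup>2 \<le> Q n (m + h) - Q n m) sequentially"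
    using eventually_ge_at_top[of "1::nat"]
  proof eventually_elim
    case (elim n)
    show ?case
    proof (intro allI impI)
      fix h assume h: "\<delta> \<le> \<bar>h\<bar>"
      show "e * h\<^sup>2 \<le> Q n (m + h) - Q n m"
      proof (cases "R \<le> \<bar>h\<bar>")
        case True
        have "e * h\<^sup>2 \<le> a / 4 * h\<^sup>2" using e_le(1) by (rule mult_right_mono) simp
        then show ?thesis using far[OF elim(2) True] by linarith
      next
        case False
        then have "h \<in> K" using h by (simp add: K_def)
        then obtain z where z: "z \<in> F" "h \<in> ball z (\<rho> z)" using F(3) by blast
        have "e * h\<^sup>2 \<le> \<epsilon> z * h\<^sup>2" using e_le(2)[OF z(1)] by (rule mult_right_mono) simp
        moreover have "\<epsilon> z * h\<^sup>2 \<le> Q n (m + h) - Q n m" using elim(1) z \<open>h \<in> K\<close> by blast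
        ultimately show ?thesis by linarith
      qed
    qed
  qed
  then show ?thesis using e by blast
qed

section \<open>Laplace asymptotics\<close>

lemma power_le_one_plus:
  fixes s :: real
  assumes "j \<le> r" "even r"
  shows "\<bar>s\<bar> ^ j \<le> 1 + s ^ r"
proof -
  have r: "s ^ r = \<bar>s\<bar> ^ r" using assms(2) by (simp add: power_even_abs)
  show ?thesis
  proof (cases "\<bar>s\<bar> \<le> 1")
    case True
    have "\<bar>s\<bar> ^ j \<le> 1" using True by (simp add: power_le_one)
    then show ?thesis using r by (simp add: add_increasing2)
  next
    case False
    have "\<bar>s\<bar> ^ j \<le> \<bar>s\<bar> ^ r" using False assms(1) by (intro power_increasing) auto
    then show ?thesis using r by linarith
  qed
qed

text \<open>In the application \<open>F n\<close> is the increment of G_n from m,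
  \<open>d n j\<close> its Taylor coefficients, c n = n^(-1/r) and \<kappa> = \<lambda>/r!. The last
  assumption is the only form in which the class hypotheses enter.\<close>

context
  fixes F :: "nat \<Rightarrow> real \<Rightarrow> real" and d :: "nat \<Rightarrow> nat \<Rightarrow> real" and c :: "nat \<Rightarrow> real"
    and \<kappa> C :: real and r :: nat
  assumes r: "r \<ge> 2" "even r" and \<kappa>: "\<kappa> > 0" and C: "C > 0"
    and c_pos: "\<And>n. n \<ge> 1 \<Longrightarrow> c n > 0" and c_power: "\<And>n. n \<ge> 1 \<Longrightarrow> real n * c n ^ r = 1"
    and c_lim: "c \<longlonglongrightarrow> 0"
    and taylor: "\<And>n h. n \<ge> 1 \<Longrightarrow> \<bar>F n h - (\<Sum>j=1..r. d n j * h ^ j)\<bar> \<le> C * \<bar>h\<bar> ^ Suc r"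
    and coef: "\<And>j. j \<in> {1..r} \<Longrightarrow> (\<lambda>n. real n * d n j * c n ^ j) \<longlonglongrightarrow> (if j = r then \<kappa> else 0)"
begin

text \<open>One factor n c^r = 1 is cancelled from the remainder, and the spare power stays as |c n
  * s|. This serves twice: it tends to 0 for fixed s, and it is a small multiple of s^r as long as
  |c n * s| is small.\<close>

lemma scaled_taylor:
  assumes n: "n \<ge> 1"
  shows "\<bar>real n * F n (c n * s) - (\<Sum>j=1..r. (real n * d n j * c n ^ j) * s ^ j)\<bar>
    \<le> C * \<bar>c n * s\<bar> * \<bar>s\<bar> ^ r"
proof -
  have "(\<Sum>j=1..r. (real n * d n j * c n ^ j) * s ^ j) = real n * (\<Sum>j=1..r. d n j * (c n * s) ^ j)"
    by (simp add: sum_distrib_left power_mult_distrib ac_simps)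
  then have "\<bar>real n * F n (c n * s) - (\<Sum>j=1..r. (real n * d n j * c n ^ j) * s ^ j)\<bar>
      = real n * \<bar>F n (c n * s) - (\<Sum>j=1..r. d n j * (c n * s) ^ j)\<bar>"
    by (simp only: right_diff_distrib[symmetric] abs_mult abs_of_nat)
  also have "\<dots> \<le> real n * (C * \<bar>c n * s\<bar> ^ Suc r)"
    using taylor[OF n] by (intro mult_left_mono) auto
  also have "\<bar>c n * s\<bar> ^ Suc r = \<bar>c n * s\<bar> * (c n ^ r * \<bar>s\<bar> ^ r)"
    using c_pos[OF n] by (simp add: abs_mult power_mult_distrib)
  also have "real n * (C * (\<bar>c n * s\<bar> * (c n ^ r * \<bar>s\<bar> ^ r))) = (real n * c n ^ r) * (C * \<bar>c n * s\<bar> * \<bar>s\<bar> ^ r)"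
    by (simp only: mult_ac)
  finally show ?thesis using c_power[OF n] by simp
qed

lemma scaled_limit: "(\<lambda>n. real n * F n (c n * s)) \<longlonglongrightarrow> \<kappa> * s ^ r"
proof -
  define S where "S n = (\<Sum>j=1..r. (real n * d n j * c n ^ j) * s ^ j)" for n
  have "S \<longlonglongrightarrow> (\<Sum>j=1..r. (if j = r then \<kappa> else 0) * s ^ j)"
    unfolding S_def by (intro tendsto_intros coef)
  also have "(\<Sum>j=1..r. (if j = r then \<kappa> else 0) * s ^ j) = (\<Sum>j=1..r. if j = r then \<kappa> * s ^ j else 0)"
    by (rule sum.cong) auto
  also have "\<dots> = \<kappa> * s ^ r" using r by simp
  finally have S: "S \<longlonglongrightarrow> \<kappa> * s ^ r" .
  have "(\<lambda>n. real n * F n (c n * s) - S n) \<longlonglongrightarrow> 0"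
  proof (rule Lim_null_comparison)
    show "eventually (\<lambda>n. norm (real n * F n (c n * s) - S n) \<le> C * \<bar>c n * s\<bar> * \<bar>s\<bar> ^ r) sequentially"
      using eventually_ge_at_top[of "1::nat"]
      by eventually_elim (simp only: S_def scaled_taylor real_norm_def)
    have "(\<lambda>n. C * \<bar>c n * s\<bar> * \<bar>s\<bar> ^ r) \<longlonglongrightarrow> C * \<bar>0 * s\<bar> * \<bar>s\<bar> ^ r"
      by (intro tendsto_intros c_lim)
    then show "(\<lambda>n. C * \<bar>c n * s\<bar> * \<bar>s\<bar> ^ r) \<longlonglongrightarrow> 0" by simp
  qed
  from tendsto_add[OF this S] show ?thesis by simp
qed

text \<open>For |c n * s| < \<delta> the top Taylor term dominates; beyond that the growth of
  \<open>F n\<close> takes over. Both regimes are reduced to a quadratic in s so that one Gaussian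
  dominates.\<close>

lemma scaled_lower_bound:
  assumes tail: "\<And>\<delta>. \<delta> > 0 \<Longrightarrow>
    \<exists>\<epsilon>>0. eventually (\<lambda>n. \<forall>h. \<delta> \<le> \<bar>h\<bar> \<longrightarrow> \<epsilon> * h\<^sup>2 \<le> F n h) sequentially"
  shows "\<exists>q>0. eventually (\<lambda>n. \<forall>s. q * s\<^sup>2 - \<kappa> / 2 \<le> real n * F n (c n * s)) sequentially"
proof -
  \<comment> \<open>Budget in units of \<kappa>/4: \<delta> caps the remainder at one unit of s^r,
    and \<eta> below caps all lower-order terms together at one unit of 1 + s^r. The top coefficient
    eventually exceeds three units, so one unit of s^r is left.\<close>
  define \<delta> where "\<delta> = \<kappa> / (4 * C)"
  have \<delta>: "\<delta> > 0" "C * \<delta> = \<kappa> / 4" using \<kappa> C by (auto simp: \<delta>_def)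
  obtain \<epsilon> where \<epsilon>: "\<epsilon> > 0" and tl: "eventually (\<lambda>n. \<forall>h. \<delta> \<le> \<bar>h\<bar> \<longrightarrow> \<epsilon> * h\<^sup>2 \<le> F n h) sequentially"
    using tail[OF \<delta>(1)] by blast
  define \<eta> where "\<eta> = \<kappa> / (4 * real r)"
  have \<eta>: "\<eta> > 0" "real r * \<eta> = \<kappa> / 4" using \<kappa> r by (auto simp: \<eta>_def)
  have "eventually (\<lambda>n. \<bar>real n * d n j * c n ^ j\<bar> < \<eta>) sequentially" if "j \<in> {1..<r}" for j
  proof -
    have "(\<lambda>n. \<bar>real n * d n j * c n ^ j\<bar>) \<longlonglongrightarrow> 0"
      using coef[of j] that by (intro tendsto_rabs_zero) auto
    then show ?thesis using \<eta>(1) by (rule order_tendstoD)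
  qed
  then have small: "eventually (\<lambda>n. \<forall>j\<in>{1..<r}. \<bar>real n * d n j * c n ^ j\<bar> < \<eta>) sequentially"
    by (intro eventually_ball_finite) auto
  have top: "eventually (\<lambda>n. real n * d n r * c n ^ r > 3 / 4 * \<kappa>) sequentially"
    using coef[of r] r \<kappa> by (intro order_tendstoD(1)[where y = \<kappa>]) auto
  have c1: "eventually (\<lambda>n. c n < 1) sequentially" using c_lim by (rule order_tendstoD) simp
  define q where "q = min (\<kappa> / 4) \<epsilon>"
  have q: "q > 0" "q \<le> \<kappa> / 4" "q \<le> \<epsilon>" using \<kappa> \<epsilon> by (auto simp: q_def)
  have "eventually (\<lambda>n. \<forall>s. q * s\<^sup>2 - \<kappa> / 2 \<le> real n * F n (c n * s)) sequentially"
    using tl small top c1 eventually_ge_at_top[of "1::nat"]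
  proof eventually_elim
    case (elim n)
    note n = elim(5)
    show ?case
    proof
      fix s
      show "q * s\<^sup>2 - \<kappa> / 2 \<le> real n * F n (c n * s)"
      proof (cases "\<delta> \<le> \<bar>c n * s\<bar>")
        case True
        \<comment> \<open>With c n < 1 and r \<ge> 2, n c^2 \<ge> n c^r = 1, so the quadratic growth
          in h = c n * s becomes at least the same growth in s.\<close>
        have "c n ^ r \<le> (c n)\<^sup>2" using c_pos[OF n] elim(4) r by (intro power_decreasing) auto
        then have "1 \<le> real n * (c n)\<^sup>2"
          using c_power[OF n] mult_left_mono[of "c n ^ r" "(c n)\<^sup>2" "real n"] by simp
        then have "1 * (\<epsilon> * s\<^sup>2) \<le> (real n * (c n)\<^sup>2) * (\<epsilon> * s\<^sup>2)" using \<epsilon> by (intro mult_right_mono) auto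
        also have "\<dots> = real n * (\<epsilon> * (c n * s)\<^sup>2)" by (simp add: power_mult_distrib ac_simps)
        also have "\<dots> \<le> real n * F n (c n * s)" using elim(1) True by (intro mult_left_mono) auto
        finally have "\<epsilon> * s\<^sup>2 \<le> real n * F n (c n * s)" by simp
        moreover have "q * s\<^sup>2 \<le> \<epsilon> * s\<^sup>2" using q(3) by (rule mult_right_mono) simp
        ultimately show ?thesis using \<kappa> by linarith
      next
        case False
        have sr: "s ^ r = \<bar>s\<bar> ^ r" using r(2) by (simp add: power_even_abs)
        have sr0: "s ^ r \<ge> 0" unfolding sr by simp
        have "C * \<bar>c n * s\<bar> * \<bar>s\<bar> ^ r \<le> C * \<delta> * \<bar>s\<bar> ^ r"
          using False C by (intro mult_right_mono mult_left_mono) auto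
        then have R: "C * \<bar>c n * s\<bar> * \<bar>s\<bar> ^ r \<le> \<kappa> / 4 * s ^ r" by (simp only: \<delta>(2) sr)
        have split: "(\<Sum>j=1..r. (real n * d n j * c n ^ j) * s ^ j) =
            (\<Sum>j\<in>{1..<r}. (real n * d n j * c n ^ j) * s ^ j) + (real n * d n r * c n ^ r) * s ^ r"
          using r by (subst sum.last_plus) (auto simp: add.commute)
        have "\<bar>\<Sum>j\<in>{1..<r}. (real n * d n j * c n ^ j) * s ^ j\<bar> \<le> (\<Sum>j\<in>{1..<r}. \<eta> * (1 + s ^ r))"
        proof (rule sum_abs[THEN order_trans], rule sum_mono)
          fix j assume j: "j \<in> {1..<r}"
          show "\<bar>(real n * d n j * c n ^ j) * s ^ j\<bar> \<le> \<eta> * (1 + s ^ r)"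
            unfolding abs_mult[of _ "s ^ j"] power_abs
          proof (rule mult_mono)
            show "\<bar>real n * d n j * c n ^ j\<bar> \<le> \<eta>" using elim(2) j by (auto intro: less_imp_le)
            show "\<bar>s\<bar> ^ j \<le> 1 + s ^ r" using j r(2) by (intro power_le_one_plus) auto
          qed (use \<eta>(1) in auto)
        qed
        also have "\<dots> \<le> real r * (\<eta> * (1 + s ^ r))"
          using \<eta>(1) sr0 by (auto intro!: mult_right_mono mult_nonneg_nonneg)
        also have "\<dots> = \<kappa> / 4 * (1 + s ^ r)" using \<eta>(2) by (metis mult.assoc)
        finally have low: "\<bar>\<Sum>j\<in>{1..<r}. (real n * d n j * c n ^ j) * s ^ j\<bar> \<le> \<kappa> / 4 + \<kappa> / 4 * s ^ r"
          by (simp only: distrib_left mult_1_right)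
        have "3 / 4 * \<kappa> * s ^ r \<le> (real n * d n r * c n ^ r) * s ^ r"
          using elim(3) sr0 by (intro mult_right_mono) auto
        then have "\<kappa> / 4 * s ^ r - \<kappa> / 4 \<le> real n * F n (c n * s)"
          using scaled_taylor[OF n, of s] R low split by (simp only: abs_le_iff) linarith
        \<comment> \<open>s^2 - 1 \<le> s^r trades degree r for degree 2; the extra \<kappa>/4 lost
          makes the constant \<kappa>/2.\<close>
        moreover have "\<kappa> / 4 * (s\<^sup>2 - 1) \<le> \<kappa> / 4 * s ^ r"
          using power_le_one_plus[of 2 r s] r \<kappa> by (intro mult_left_mono) auto
        moreover have "q * s\<^sup>2 \<le> \<kappa> / 4 * s\<^sup>2" using q(2) by (rule mult_right_mono) simp
        ultimately show ?thesis by (simp add: right_diff_distrib)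
      qed
    qed
  qed
  then show ?thesis using q(1) by blast
qed

end

section \<open>Convergence of Fourier integrals and the limit law\<close>

lemma integrable_gaussian:
  fixes q :: real
  assumes "q > 0"
  shows "integrable lborel (\<lambda>s. exp (- q * s\<^sup>2))"
proof -
  have "integrable lborel (\<lambda>s. norm (iexp (0 * s) * complex_of_real (exp (- (2 * q / 2) * (s - 0)\<^sup>2))))"
    using assms by (intro integrable_norm gaussian_fourier(1)) simp
  then show ?thesis by simp
qed

text \<open>The lower bound makes e^D exp(-q s^2) a dominating function, but only from some N on;
  hence the shifted sequence.\<close>

lemma laplace_fourier_limit:
  fixes g :: "nat \<Rightarrow> real \<Rightarrow> real" and P :: "real \<Rightarrow> real"
  assumes lim: "\<And>s. (\<lambda>n. g n s) \<longlonglongrightarrow> P s"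
    and low: "eventually (\<lambda>n. \<forall>s. q * s\<^sup>2 - D \<le> g n s) sequentially" and q: "q > 0"
    and g [measurable]: "\<And>n. g n \<in> borel_measurable borel"
  shows "(\<lambda>n. LBINT s. iexp (t * s) * complex_of_real (exp (- g n s)))
    \<longlonglongrightarrow> (LBINT s. iexp (t * s) * complex_of_real (exp (- P s)))"
proof -
  have [measurable]: "P \<in> borel_measurable borel"
    by (rule borel_measurable_LIMSEQ_real[OF lim g])
  obtain N where N: "\<And>n s. n \<ge> N \<Longrightarrow> q * s\<^sup>2 - D \<le> g n s"
    using low unfolding eventually_sequentially by blast
  have "(\<lambda>n. LBINT s. iexp (t * s) * complex_of_real (exp (- g (n + N) s)))
    \<longlonglongrightarrow> (LBINT s. iexp (t * s) * complex_of_real (exp (- P s)))"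
  proof (rule integral_dominated_convergence[where w = "\<lambda>s. exp D * exp (- q * s\<^sup>2)"])
    show "integrable lborel (\<lambda>s. exp D * exp (- q * s\<^sup>2))"
      using integrable_gaussian[OF q] by (rule integrable_mult_right)
    show "AE s in lborel. (\<lambda>n. iexp (t * s) * complex_of_real (exp (- g (n + N) s)))
        \<longlonglongrightarrow> iexp (t * s) * complex_of_real (exp (- P s))"
      by (intro AE_I2 tendsto_intros LIMSEQ_ignore_initial_segment[OF lim])
    show "AE s in lborel. norm (iexp (t * s) * complex_of_real (exp (- g (n + N) s))) \<le> exp D * exp (- q * s\<^sup>2)" for n
    proof (rule AE_I2)
      fix s
      have "- g (n + N) s \<le> D + - q * s\<^sup>2" using N[of "n + N" s] by simp
      then have "exp (- g (n + N) s) \<le> exp D * exp (- q * s\<^sup>2)" by (simp only: exp_add[symmetric] exp_le_cancel_iff)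
      then show "norm (iexp (t * s) * complex_of_real (exp (- g (n + N) s))) \<le> exp D * exp (- q * s\<^sup>2)"
        by (simp add: norm_mult)
    qed
  qed measurable
  then show ?thesis by (rule LIMSEQ_offset)
qed

context
  fixes r :: nat and l :: real
  assumes r: "r \<ge> 2" "even r" and l: "l > 0"
begin

lemma integrable_exp_power: "integrable lborel (\<lambda>s. exp (- l * s ^ r / fact r))"
proof (rule Bochner_Integration.integrable_bound)
  define q where "q = l / fact r"
  have q: "q > 0" using l by (simp add: q_def)
  show "integrable lborel (\<lambda>s. exp q * exp (- q * s\<^sup>2))"
    using integrable_gaussian[OF q] by (rule integrable_mult_right)
  show "AE s in lborel. norm (exp (- l * s ^ r / fact r)) \<le> norm (exp q * exp (- q * s\<^sup>2))"
  proof (rule AE_I2)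
    fix s :: real
    have "q * s\<^sup>2 \<le> q * (1 + s ^ r)"
      using power_le_one_plus[of 2 r s] r q by (intro mult_left_mono) auto
    then have "- l * s ^ r / fact r \<le> q + - q * s\<^sup>2" by (simp add: q_def distrib_left)
    then show "norm (exp (- l * s ^ r / fact r)) \<le> norm (exp q * exp (- q * s\<^sup>2))"
      by (simp add: exp_add[symmetric])
  qed
qed measurable

lemma integral_exp_power_pos: "(\<integral>s. exp (- l * s ^ r / fact r) \<partial>lborel) > 0"
proof -
  have "\<not> (AE s in lborel. exp (- l * s ^ r / fact r) = 0)"
    by (simp add: eventually_False ae_filter_eq_bot_iff)
  then have "(\<integral>s. exp (- l * s ^ r / fact r) \<partial>lborel) \<noteq> 0"
    using integral_nonneg_eq_0_iff_AE[OF integrable_exp_power] by simp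
  moreover have "(\<integral>s. exp (- l * s ^ r / fact r) \<partial>lborel) \<ge> 0" by simp
  ultimately show ?thesis by linarith
qed

lemma real_distribution_Z_law: "real_distribution (Z_law r (ereal l))"
proof -
  define I where "I = (\<integral>s. exp (- l * s ^ r / fact r) \<partial>lborel)"
  have I: "I > 0" unfolding I_def by (rule integral_exp_power_pos)
  have Z: "Z_density r l s = exp (- l * s ^ r / fact r) / I" for s
    by (simp add: Z_density_def I_def)
  have "(\<integral>\<^sup>+s. ennreal (exp (- l * s ^ r / fact r) / I) \<partial>lborel) = ennreal (\<integral>s. exp (- l * s ^ r / fact r) / I \<partial>lborel)"
    using I integrable_exp_power by (intro nn_integral_eq_integral) auto
  also have "(\<integral>s. exp (- l * s ^ r / fact r) / I \<partial>lborel) = 1"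
    using I by (simp add: I_def)
  finally have 1: "(\<integral>\<^sup>+s. ennreal (exp (- l * s ^ r / fact r) / I) \<partial>lborel) = 1" by simp
  interpret prob_space "Z_law r (ereal l)"
    by (rule prob_spaceI) (use 1 in \<open>simp add: Z_law_def Z emeasure_density\<close>)
  show ?thesis by standard (auto simp: Z_law_def)
qed

text \<open>A ratio of Fourier integrals is the form delivered by
  \<open>char_gibbs_eq_fourier\<close>, so the normalizing constant is never evaluated.\<close>

lemma char_Z_law:
  "char (Z_law r (ereal l)) t =
    (LBINT s. iexp (t * s) * complex_of_real (exp (- l * s ^ r / fact r))) /
    (LBINT s. iexp (0 * s) * complex_of_real (exp (- l * s ^ r / fact r)))"
proof -
  define I where "I = (\<integral>s. exp (- l * s ^ r / fact r) \<partial>lborel)"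
  have I: "I > 0" unfolding I_def by (rule integral_exp_power_pos)
  have "char (Z_law r (ereal l)) t = (LBINT s. Z_density r l s *\<^sub>R iexp (t * s))"
  proof -
    have "Z_density r l \<in> borel_measurable borel" "\<And>s. Z_density r l s \<ge> 0"
      using I unfolding Z_density_def I_def[symmetric] by auto
    then show ?thesis
      by (simp add: char_def Z_law_def integral_density)
  qed
  also have "\<dots> = (LBINT s. iexp (t * s) * complex_of_real (exp (- l * s ^ r / fact r)) / complex_of_real I)"
    unfolding Z_density_def I_def[symmetric]
    by (intro Bochner_Integration.integral_cong) (simp_all add: scaleR_conv_of_real)
  also have "\<dots> = (LBINT s. iexp (t * s) * complex_of_real (exp (- l * s ^ r / fact r))) / complex_of_real I"
    by (rule integral_divide_zero)
  also have "complex_of_real I = (LBINT s. iexp (0 * s) * complex_of_real (exp (- l * s ^ r / fact r)))"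
    by (simp add: I_def del: of_real_exp)
  finally show ?thesis .
qed

end

section \<open>The limit theorem\<close>

lemma tilde_lambda_eq:
  "tilde_lambda \<beta> J k lam = (if k = 1
     then (if 1 / lam - 1 / (\<beta> * J) = 0 then \<infinity> else ereal (1 / (1 / lam - 1 / (\<beta> * J))))
     else ereal lam)"
  by (simp add: tilde_lambda_def inverse_eq_divide)

text \<open>The exponent - l s^2 / 2! is that of a centred Gaussian of variance 1/l.\<close>

lemma gaussian_char_Z_law:
  assumes "l > 0"
  shows "char (Z_law 2 (ereal l)) t = complex_of_real (exp (- t\<^sup>2 / (2 * l)))"
proof -
  have "exp (- l * s ^ 2 / fact 2) = exp (- (l / 2) * (s - 0)\<^sup>2)" for s :: real by (simp add: fact_2)
  then have g: "(LBINT s. iexp (t * s) * complex_of_real (exp (- l * s ^ 2 / fact 2))) =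
      complex_of_real (sqrt (2 * pi / l)) * complex_of_real (exp (- t\<^sup>2 / (2 * l)))" for t
    using gaussian_fourier(2)[OF assms, of t 0] by simp
  then show ?thesis
    using assms unfolding char_Z_law[OF order_refl even_numeral assms]
    by (simp only: g) simp
qed

text \<open>The inequality \<open>1 / lam \<ge> 1 / a\<close> comes for free, since characteristic functions are
  bounded by \<open>1\<close>.\<close>

lemma weak_conv_gaussian_deconvolution:
  assumes M: "\<And>n. real_distribution (M n)" and "lam > 0" "a > 0"
    and lim: "\<And>t. (\<lambda>n. char (M n) t * complex_of_real (exp (- t\<^sup>2 / (2 * a)))) \<longlonglongrightarrow>
      char (Z_law 2 (ereal lam)) t"
  shows "weak_conv_m M (Z_law 2 (if 1 / lam - 1 / a = 0 then \<infinity> else ereal (1 / (1 / lam - 1 / a))))"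
proof -
  define q where "q = 1 / lam - 1 / a"
  have ch: "(\<lambda>n. char (M n) t) \<longlonglongrightarrow> complex_of_real (exp (- q * t\<^sup>2 / 2))" for t
  proof -
    have "(\<lambda>n. char (M n) t * complex_of_real (exp (- t\<^sup>2 / (2 * a))) * complex_of_real (exp (t\<^sup>2 / (2 * a)))) \<longlonglongrightarrow>
        complex_of_real (exp (- t\<^sup>2 / (2 * lam))) * complex_of_real (exp (t\<^sup>2 / (2 * a)))"
      using lim[of t] gaussian_char_Z_law[OF \<open>lam > 0\<close>] by (intro tendsto_intros) simp
    moreover have "- t\<^sup>2 / (2 * lam) + t\<^sup>2 / (2 * a) = - q * t\<^sup>2 / 2"
      by (simp add: q_def field_simps)
    then have "complex_of_real (exp (- t\<^sup>2 / (2 * lam))) * complex_of_real (exp (t\<^sup>2 / (2 * a))) =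
        complex_of_real (exp (- q * t\<^sup>2 / 2))"
      by (simp only: of_real_mult[symmetric] exp_add[symmetric])
    moreover have "exp (- t\<^sup>2 / (2 * a)) * exp (t\<^sup>2 / (2 * a)) = 1"
      by (simp add: exp_add[symmetric])
    then have "complex_of_real (exp (- t\<^sup>2 / (2 * a))) * complex_of_real (exp (t\<^sup>2 / (2 * a))) = 1"
      by (simp only: of_real_mult[symmetric] of_real_1)
    ultimately show ?thesis by (simp only: mult.assoc mult_1_right)
  qed
  have "q \<ge> 0"
  proof -
    have "(\<lambda>n. norm (char (M n) 1)) \<longlonglongrightarrow> norm (complex_of_real (exp (- q * 1\<^sup>2 / 2)))"
      by (intro tendsto_norm ch)
    then have "norm (complex_of_real (exp (- q * 1\<^sup>2 / 2))) \<le> 1"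
      by (rule LIMSEQ_le_const2) (use real_distribution.cmod_char_le_1[OF M] in blast)
    then have "exp (- q / 2) \<le> 1" by (simp only: norm_of_real abs_exp_cancel) simp
    then show ?thesis by simp
  qed
  show ?thesis
  proof (cases "q = 0")
    case True
    \<comment> \<open>Here lam = a: the added Gaussian already accounts for the whole limit, and
      dividing it out leaves the constant 1, the characteristic function of the point mass at
      0.\<close>
    have "prob_space (return borel (0::real))" by (rule prob_space_return) simp
    then interpret prob_space "return borel (0::real)" .
    have "real_distribution (return borel (0::real))" by standard auto
    moreover have "char (return borel 0) t = 1" for t by (simp add: char_def integral_return)
    ultimately have "weak_conv_m M (return borel 0)"
      using ch True M by (intro levy_continuity) auto
    then show ?thesis using True by (simp add: q_def[symmetric] Z_law_def)
  next
    case False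
    then have q: "q > 0" using \<open>q \<ge> 0\<close> by simp
    then have "1 / q > 0" by simp
    have "weak_conv_m M (Z_law 2 (ereal (1 / q)))"
    proof (rule levy_continuity[OF M])
      show "real_distribution (Z_law 2 (ereal (1 / q)))"
        by (rule real_distribution_Z_law[OF order_refl even_numeral \<open>1 / q > 0\<close>])
      show "(\<lambda>n. char (M n) t) \<longlonglongrightarrow> char (Z_law 2 (ereal (1 / q))) t" for t
        using ch[of t] gaussian_char_Z_law[OF \<open>1 / q > 0\<close>, of t] by (simp add: mult.commute)
    qed
    then show ?thesis using False by (simp add: q_def[symmetric])
  qed
qed

theorem theorem3p3:
  fixes E :: "'a::metric_space set"
    and T :: "'a \<Rightarrow> 'a"
    and \<mu> :: "'a measure"
    and f :: "'a \<Rightarrow> real"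
    and x :: 'a
    and \<beta> J m lam :: real
    and k :: nat
  assumes "compact E"
    and "continuous_on E T" and "T ` E \<subseteq> E"
    and "uniquely_ergodic E T \<mu>"
    and "continuous_on E f" and "f ` E \<subseteq> {0..1}"
    and "x \<in> E"
    and "\<beta> > 0" and "J > 0"
    and "{s. \<forall>t. G \<beta> J f \<mu> s \<le> G \<beta> J f \<mu> t} = {m}"
    and "has_type (G \<beta> J f \<mu>) m (2 * k)"
    and "lam = (deriv ^^ (2 * k)) (G \<beta> J f \<mu>) m"
    and "\<And>j. j \<in> {1..2 * k} \<Longrightarrow>
           (\<lambda>y. (deriv ^^ j) (L (f y)) (\<beta> * J * m))
             \<in> class_C (real j / real (2 * k)) E T \<mu>"
  shows "weak_conv_m
           (\<lambda>n. distr (gibbs \<beta> J f T n x) borel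
                  (\<lambda>\<sigma>. (magnetization n \<sigma> - real n * m) /
                         real n powr (1 - 1 / real (2 * k))))
           (Z_law (2 * k) (tilde_lambda \<beta> J k lam))"
proof -
  define r where "r = 2 * k"
  define a where "a = \<beta> * J"
  have a: "a > 0" using assms(8,9) by (simp add: a_def)
  \<comment> \<open>A type is at least 1 by definition, which rules out k = 0.\<close>
  have r: "r \<ge> 2" "even r" using assms(11) by (auto simp: r_def has_type_def)
  have \<mu>: "prob_space \<mu>" "sets \<mu> = sets (restrict_space borel E)"
    using assms(4) by (auto simp: uniquely_ergodic_def invariant_prob_def)
  interpret \<mu>: prob_space \<mu> by (rule \<mu>(1))
  have sp: "space \<mu> = E" using sets_eq_imp_space_eq[OF \<mu>(2)] by (simp add: space_restrict_space)
  have f_in: "f y \<in> {0..1}" if "y \<in> E" for y using assms(6) that by blast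
  have fm: "f \<in> borel_measurable \<mu>"
    using borel_measurable_continuous_on_restrict[OF assms(5)]
    by (simp add: measurable_cong_sets[OF \<mu>(2) refl])
  have f_sp: "f y \<in> {0..1}" if "y \<in> space \<mu>" for y using f_in that sp by simp
  define P where "P = potential a \<mu> f"
  have G_eq: "G \<beta> J f \<mu> = P 0"
    by (simp add: fun_eq_iff G_def P_def potential_def quad_deriv_def a_def)
  have deriv_G: "(deriv ^^ j) (G \<beta> J f \<mu>) = P j" for j
    unfolding G_eq P_def by (rule \<mu>.iterated_deriv_potential[OF fm f_sp a])

  \<comment> \<open>The potential averaged along the orbit\<close>
  define \<phi> where "\<phi> i = f ((T ^^ i) x)" for i
  have orbit: "(T ^^ i) x \<in> E" for i using assms(3,7) by (rule funpow_in)
  have \<phi>_in: "\<phi> i \<in> {0..1}" for i unfolding \<phi>_def by (rule f_in[OF orbit])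
  \<comment> \<open>A measure on indices rather than on E: no point of the orbit needs to be
    distinct from another, and G_n becomes a \<open>potential\<close>.\<close>
  define \<nu> where "\<nu> n = uniform_count_measure {1..n}" for n :: nat
  define Q where "Q n = potential a (\<nu> n) \<phi>" for n
  have \<nu>: "prob_space (\<nu> n)" "\<phi> \<in> borel_measurable (\<nu> n)" if "n \<ge> 1" for n
  proof -
    show "prob_space (\<nu> n)" unfolding \<nu>_def using that by (intro prob_space_uniform_count_measure) auto
    show "\<phi> \<in> borel_measurable (\<nu> n)" by (simp add: \<nu>_def measurable_def uniform_count_measure_def)
  qed
  have \<nu>_int: "(\<integral>i. h i \<partial>\<nu> n) = (\<Sum>i=1..n. h i) / real n" for n and h :: "nat \<Rightarrow> real"
    unfolding \<nu>_def by (simp add: integral_uniform_count_measure)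

  \<comment> \<open>Behaviour of the limit potential at its minimum\<close>
  have P_m: "P j m = 0" if "j \<in> {1..<r}" for j
    using assms(11) that unfolding has_type_def deriv_G r_def by fastforce
  have P_r: "P r m = lam" "lam \<noteq> 0"
    using assms(11,12) unfolding has_type_def deriv_G r_def by auto
  have P_min: "P 0 m < P 0 s" if "s \<noteq> m" for s
  proof -
    have "m \<in> {s. \<forall>t. P 0 s \<le> P 0 t}" "s \<notin> {s. \<forall>t. P 0 s \<le> P 0 t}"
      using assms(10) that unfolding G_eq by auto
    then show ?thesis by (auto simp: not_le) (meson le_less_trans)
  qed
  obtain B where B: "B > 0" "\<And>\<phi> s. \<phi> \<in> {0..1} \<Longrightarrow> \<bar>L_deriv (Suc r) \<phi> s\<bar> \<le> B"
    using L_deriv_bounded[of r] by blast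
  define C where "C = a ^ Suc r * B"
  have C: "C > 0" using a B(1) by (simp add: C_def)
  have P_taylor: "\<bar>P 0 (m + h) - P 0 m - (\<Sum>j=1..r. P j m / fact j * h ^ j)\<bar> \<le> C * \<bar>h\<bar> ^ Suc r" for h
    unfolding P_def C_def by (rule \<mu>.potential_taylor[OF fm f_sp a B(2) r(1)])
  \<comment> \<open>Near m the increment of P is lam h^r / r! up to O(h^(r+1)) and is positive.
    Dividing by h^r and letting h decrease to 0 gives lam \<ge> 0; the type excludes 0.\<close>
  have lam: "lam > 0"
  proof -
    have sum: "(\<Sum>j=1..r. P j m / fact j * h ^ j) = lam / fact r * h ^ r" for h
    proof -
      have "(\<Sum>j=1..r. P j m / fact j * h ^ j) = (\<Sum>j=1..r. if j = r then lam / fact r * h ^ r else 0)"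
        using P_m P_r(1) by (intro sum.cong refl) auto
      then show ?thesis using r by simp
    qed
    have bound: "- C * h \<le> lam / fact r" if "h > 0" for h
    proof -
      have "- (C * h * h ^ r) \<le> lam / fact r * h ^ r"
        using P_taylor[of h] P_min[of "m + h"] that unfolding sum by (simp add: abs_le_iff)
      then have "- C * h * h ^ r \<le> lam / fact r * h ^ r" by simp
      then show ?thesis using that by (simp only: mult_le_cancel_right_pos zero_less_power)
    qed
    have "((\<lambda>h. - C * h) \<longlongrightarrow> - C * 0) (at_right 0)"
      by (intro tendsto_intros)
    moreover have "eventually (\<lambda>h. - C * h \<le> lam / fact r) (at_right 0)"
      by (rule eventually_mono[OF eventually_at_right_less bound])
    ultimately have "- C * 0 \<le> lam / fact r"
      by (rule tendsto_upperbound) simp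
    then have "0 \<le> lam" using pos_le_divide_eq[of "fact r" 0 lam] by simp
    then show ?thesis using P_r(2) by simp
  qed

  \<comment> \<open>Scaling and Taylor coefficients\<close>
  define c where "c n = real n powr (- 1 / real r)" for n :: nat
  have c_pow: "c n ^ j = real n powr (- (real j / real r))" if "n \<ge> 1" for n j
    using that by (simp add: c_def powr_realpow[symmetric] powr_powr)
  have c_pos: "c n > 0" if "n \<ge> 1" for n using that by (simp add: c_def)
  have c_power: "real n * c n ^ r = 1" if "n \<ge> 1" for n
    using that r by (simp add: c_pow powr_minus)
  have c_lim: "c \<longlonglongrightarrow> 0"
    unfolding c_def using r by (intro tendsto_neg_powr filterlim_real_sequentially) auto
  have scale: "real n powr (1 - 1 / real (2 * k)) = real n * c n" if "n \<ge> 1" for n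
  proof -
    have "1 - 1 / real (2 * k) = 1 + (- 1 / real r)" by (simp add: r_def)
    then show ?thesis using that by (simp only: powr_add c_def powr_one_gt_zero_iff of_nat_0_less_iff) simp
  qed

  define d where "d n j = Q n j m / fact j" for n j
  \<comment> \<open>With S n the centred orbit sum of the j-th derivative, n Q^(j)(m) = n P^(j)(m) -
    a^j S n. Multiplied by c^j = n^(-j/r), the first term is 0 for j < r and lam for j = r, and the
    second tends to 0 by the class condition taken at the point x.\<close>
  have coef: "(\<lambda>n. real n * d n j * c n ^ j) \<longlonglongrightarrow> (if j = r then lam / fact r else 0)" if j: "j \<in> {1..r}" for j
  proof -
    define h where "h y = L_deriv j (f y) (a * m)" for y
    have h: "(deriv ^^ j) (L (f y)) (\<beta> * J * m) = h y" if "y \<in> E" for y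
      unfolding h_def a_def by (simp only: iterated_deriv_L[OF f_in[OF that]])
    have hint: "integral\<^sup>L \<mu> (\<lambda>y. (deriv ^^ j) (L (f y)) (\<beta> * J * m)) = integral\<^sup>L \<mu> h"
      using h sp by (intro Bochner_Integration.integral_cong) auto
    define S where "S n = (\<Sum>i=1..n. (h ((T ^^ i) x) - integral\<^sup>L \<mu> h))" for n
    have S_eq: "S n = (\<Sum>i=1..n. ((deriv ^^ j) (L (f ((T ^^ i) x))) (\<beta> * J * m)
        - integral\<^sup>L \<mu> (\<lambda>y. (deriv ^^ j) (L (f y)) (\<beta> * J * m))))" for n
      unfolding S_def hint h[OF orbit] ..
    have "(\<lambda>n. \<bar>S n\<bar>) \<in> o(\<lambda>n. real n powr (real j / real r))"
      using assms(13)[of j] j assms(7) unfolding class_C_def S_eq r_def by blast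
    then have "(\<lambda>n. \<bar>S n\<bar> / real n powr (real j / real r)) \<longlonglongrightarrow> 0" by (rule smalloD_tendsto)
    then have S0: "(\<lambda>n. S n / real n powr (real j / real r)) \<longlonglongrightarrow> 0"
      by (subst tendsto_rabs_zero_iff[symmetric]) (simp add: abs_divide)
    have eq: "real n * d n j * c n ^ j =
        (real n * P j m * c n ^ j - a ^ j * (S n / real n powr (real j / real r))) / fact j" if n: "n \<ge> 1" for n
    proof -
      have sum_h: "(\<Sum>i=1..n. h ((T ^^ i) x)) = S n + real n * integral\<^sup>L \<mu> h"
        by (simp add: S_def sum_subtractf)
      have "real n * Q n j m = real n * P j m - a ^ j * S n"
        using n unfolding Q_def P_def potential_def \<nu>_int \<phi>_def h_def[symmetric] sum_h
        by (simp add: field_simps)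
      then have "real n * d n j * c n ^ j = (real n * P j m - a ^ j * S n) * c n ^ j / fact j"
        by (simp add: d_def)
      also have "\<dots> = (real n * P j m * c n ^ j - a ^ j * (S n / real n powr (real j / real r))) / fact j"
        unfolding left_diff_distrib using n by (simp add: c_pow powr_minus divide_inverse)
      finally show ?thesis .
    qed
    have "real n * P j m * c n ^ j = (if j = r then lam else 0)" if "n \<ge> 1" for n
    proof (cases "j = r")
      case True
      have "real n * P r m * c n ^ r = P r m * (real n * c n ^ r)" by (simp only: mult_ac)
      then show ?thesis using c_power[OF that] P_r(1) True by simp
    next
      case False
      then have "P j m = 0" using j by (intro P_m) auto
      then show ?thesis using False by simp
    qed
    then have "eventually (\<lambda>n. ((if j = r then lam else 0) - a ^ j * (S n / real n powr (real j / real r))) / fact j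
        = real n * d n j * c n ^ j) sequentially"
      using eq by (intro eventually_sequentiallyI[of 1]) simp
    moreover have "(\<lambda>n. ((if j = r then lam else 0) - a ^ j * (S n / real n powr (real j / real r))) / fact j)
        \<longlonglongrightarrow> ((if j = r then lam else 0) - a ^ j * 0) / fact j"
      by (intro tendsto_intros S0) simp
    ultimately have "(\<lambda>n. real n * d n j * c n ^ j) \<longlonglongrightarrow> ((if j = r then lam else 0) - a ^ j * 0) / fact j"
      by (rule Lim_transform_eventually[rotated])
    then show ?thesis by (cases "j = r") simp_all
  qed

  \<comment> \<open>The class hypotheses say nothing away from m; there the values of Q are
    controlled by unique ergodicity, applied to the continuous function y \<mapsto> L (f y) (a
    s).\<close>
  have Q_conv: "(\<lambda>n. Q n 0 s) \<longlonglongrightarrow> P 0 s" for s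
  proof -
    have "continuous_on E (\<lambda>y. L_deriv 0 (f y) (a * s))"
      using f_in assms(5) by (rule continuous_on_L_deriv)
    from uniquely_ergodic_averages[OF assms(1,2,3,4) this assms(7)]
    have "(\<lambda>n. quad_deriv a 0 s - a ^ 0 * ((\<Sum>i=1..n. L_deriv 0 (\<phi> i) (a * s)) / real n)) \<longlonglongrightarrow>
        quad_deriv a 0 s - a ^ 0 * (\<integral>y. L_deriv 0 (f y) (a * s) \<partial>\<mu>)"
      unfolding \<phi>_def by (intro tendsto_intros)
    then show ?thesis by (simp only: Q_def P_def potential_def \<nu>_int)
  qed
  define F where "F n h = Q n 0 (m + h) - Q n 0 m" for n h
  have tail: "\<exists>\<epsilon>>0. eventually (\<lambda>n. \<forall>h. \<delta> \<le> \<bar>h\<bar> \<longrightarrow> \<epsilon> * h\<^sup>2 \<le> F n h) sequentially" if "\<delta> > 0" for \<delta>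
    unfolding F_def
  proof (rule uniform_quadratic_growth[where a = a and P = "P 0", OF a that])
    fix n :: nat assume n: "n \<ge> 1"
    interpret \<nu>: prob_space "\<nu> n" by (rule \<nu>(1)[OF n])
    show "a / 2 * s\<^sup>2 - a * \<bar>s\<bar> \<le> Q n 0 s" "Q n 0 s \<le> a / 2 * s\<^sup>2 + a * \<bar>s\<bar>" for s
      unfolding Q_def using \<nu>.potential_bounds[OF \<nu>(2)[OF n] \<phi>_in a] by blast+
    show "\<bar>Q n 0 s - Q n 0 t\<bar> \<le> a * (1 + \<bar>s\<bar> + \<bar>t\<bar>) * \<bar>s - t\<bar>" for s t
      unfolding Q_def by (rule \<nu>.potential_local_lipschitz[OF \<nu>(2)[OF n] \<phi>_in a])
  qed (rule Q_conv, rule P_min)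
  have taylor: "\<bar>F n h - (\<Sum>j=1..r. d n j * h ^ j)\<bar> \<le> C * \<bar>h\<bar> ^ Suc r" if n: "n \<ge> 1" for n h
  proof -
    interpret \<nu>: prob_space "\<nu> n" by (rule \<nu>(1)[OF n])
    show ?thesis
      unfolding F_def d_def Q_def C_def
      by (rule \<nu>.potential_taylor[OF \<nu>(2)[OF n] \<phi>_in a B(2) r(1)])
  qed
  have \<kappa>: "lam / fact r > 0" using lam by simp
  note scaled = r \<kappa> C c_pos c_power c_lim taylor coef
  have lim: "(\<lambda>n. real n * F n (c n * s)) \<longlonglongrightarrow> lam / fact r * s ^ r" for s
    by (rule scaled_limit[OF scaled])
  obtain q where q: "q > 0"
    and low: "eventually (\<lambda>n. \<forall>s. q * s\<^sup>2 - lam / fact r / 2 \<le> real n * F n (c n * s)) sequentially"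
    using scaled_lower_bound[OF scaled tail] by blast

  \<comment> \<open>Characteristic functions and passage to the limit\<close>
  define \<Phi> where "\<Phi> n t = (LBINT s. iexp (t * s) * complex_of_real (exp (- (real n * F n (c n * s)))))" for n t
  define M where "M n = distr (gibbs \<beta> J f T n x) borel
      (\<lambda>\<sigma>. (magnetization n \<sigma> - real n * m) / real n powr (1 - 1 / real (2 * k)))" for n
  have p: "f ((T ^^ i) x) \<in> {0..1}" for i using \<phi>_in[of i] by (simp only: \<phi>_def)
  have M: "real_distribution (M n)" for n
    unfolding M_def using assms(8,9) p by (rule real_distribution_gibbs)
  have Q0: "Q n 0 v = \<beta> * J / 2 * v\<^sup>2 - (\<Sum>i=1..n. L (f ((T ^^ i) x)) (\<beta> * J * v)) / real n" for n v
    by (simp add: Q_def potential_def quad_deriv_def \<nu>_int \<phi>_def a_def)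
  have charM: "char (M n) t * complex_of_real (exp (- t\<^sup>2 / (2 * (real n * (c n)\<^sup>2 * a)))) = \<Phi> n t / \<Phi> n 0"
    if n: "n \<ge> 1" for n t
  proof -
    define \<Psi> where "\<Psi> t = (LBINT s. iexp (t * s) * complex_of_real (exp (- real n * Q n 0 (m + c n * s))))" for t
    \<comment> \<open>Recentring by the value at m costs a factor independent of t, which the ratio
      removes.\<close>
    have "\<Phi> n t = complex_of_real (exp (real n * Q n 0 m)) * \<Psi> t" for t
    proof -
      have "exp (- (real n * F n (c n * s))) = exp (real n * Q n 0 m) * exp (- real n * Q n 0 (m + c n * s))" for s
        by (simp add: F_def exp_add[symmetric] right_diff_distrib)
      then have "iexp (t * s) * complex_of_real (exp (- (real n * F n (c n * s)))) = complex_of_real (exp (real n * Q n 0 m)) *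
          (iexp (t * s) * complex_of_real (exp (- real n * Q n 0 (m + c n * s))))" for s
        by (simp only: of_real_mult mult.left_commute)
      then show ?thesis unfolding \<Phi>_def \<Psi>_def by (simp only: integral_mult_right_zero)
    qed
    then have "\<Phi> n t / \<Phi> n 0 = \<Psi> t / \<Psi> 0" by simp
    also have "\<dots> = char (M n) t * complex_of_real (exp (- t\<^sup>2 / (2 * (real n * (c n)\<^sup>2 * a))))"
      unfolding \<Psi>_def Q0 M_def scale[OF n] a_def
      using n by (intro char_gibbs_eq_fourier[where f = f and T = T and x = x, OF assms(8,9) p _ c_pos[OF n], symmetric]) simp
    finally show ?thesis by simp
  qed
  have \<Phi>_lim: "(\<lambda>n. \<Phi> n t) \<longlonglongrightarrow> (LBINT s. iexp (t * s) * complex_of_real (exp (- lam * s ^ r / fact r)))" for t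
  proof -
    have meas: "(\<lambda>s. real n * F n (c n * s)) \<in> borel_measurable borel" for n
      unfolding F_def Q0 L_def by measurable
    have "(\<lambda>n. \<Phi> n t) \<longlonglongrightarrow> (LBINT s. iexp (t * s) * complex_of_real (exp (- (lam / fact r * s ^ r))))"
      unfolding \<Phi>_def by (rule laplace_fourier_limit[OF lim low q meas])
    then show ?thesis by simp
  qed
  have "(LBINT s. iexp (0 * s) * complex_of_real (exp (- lam * s ^ r / fact r))) =
      complex_of_real (\<integral>s. exp (- lam * s ^ r / fact r) \<partial>lborel)"
    by (simp del: of_real_exp)
  then have "(LBINT s. iexp (0 * s) * complex_of_real (exp (- lam * s ^ r / fact r))) \<noteq> 0"
    using integral_exp_power_pos[OF r lam] by simp
  then have "(\<lambda>n. \<Phi> n t / \<Phi> n 0) \<longlonglongrightarrow> char (Z_law r (ereal lam)) t" for t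
    unfolding char_Z_law[OF r lam] by (intro tendsto_divide \<Phi>_lim)
  then have lim_prod: "(\<lambda>n. char (M n) t * complex_of_real (exp (- t\<^sup>2 / (2 * (real n * (c n)\<^sup>2 * a)))))
      \<longlonglongrightarrow> char (Z_law r (ereal lam)) t" for t
    by (rule Lim_transform_eventually) (intro eventually_sequentiallyI[of 1], simp only: charM)
  have "weak_conv_m M (Z_law r (tilde_lambda \<beta> J k lam))"
  proof (cases "k = 1")
    case True
    then have r2: "r = 2" by (simp add: r_def)
    \<comment> \<open>For r = 2, n c^2 = 1: the added Gaussian keeps variance 1/a for every n \<ge>
      1 and must be divided out.\<close>
    have "(\<lambda>n. char (M n) t * complex_of_real (exp (- t\<^sup>2 / (2 * a)))) \<longlonglongrightarrow> char (Z_law 2 (ereal lam)) t" for t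
      using lim_prod[of t] unfolding r2
      by (rule Lim_transform_eventually)
         (intro eventually_sequentiallyI[of 1], use c_power in \<open>simp only: r2 mult_1_left\<close>)
    from weak_conv_gaussian_deconvolution[OF M lam a this]
    show ?thesis unfolding tilde_lambda_eq r2 a_def using True by simp
  next
    case False
    then have k2: "k \<ge> 2" using r by (simp add: r_def)
    \<comment> \<open>For k \<ge> 2 the exponent 1 - 2/r is positive, so the variance of the added
      Gaussian tends to 0 and its characteristic function to 1.\<close>
    have nc: "real n * (c n)\<^sup>2 * a = a * real n powr (1 - 2 / real r)" if "n \<ge> 1" for n
      using that by (simp add: c_pow powr_diff powr_minus divide_inverse)
    have "filterlim (\<lambda>n. real n powr (1 - 2 / real r)) at_top sequentially"
      using k2 by (intro filterlim_compose[OF real_powr_at_top filterlim_real_sequentially]) (simp add: r_def)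
    then have top: "filterlim (\<lambda>n. a * real n powr (1 - 2 / real r)) at_top sequentially"
      using a by (intro filterlim_tendsto_pos_mult_at_top[OF tendsto_const])
    have fac: "(\<lambda>n. complex_of_real (exp (- t\<^sup>2 / (2 * (real n * (c n)\<^sup>2 * a))))) \<longlonglongrightarrow> 1" for t
    proof -
      have "(\<lambda>n. complex_of_real (exp ((- t\<^sup>2 / 2) / (a * real n powr (1 - 2 / real r))))) \<longlonglongrightarrow> complex_of_real (exp 0)"
        by (intro tendsto_of_real tendsto_exp tendsto_divide_0[OF tendsto_const] filterlim_at_top_imp_at_infinity top)
      moreover have "eventually (\<lambda>n. complex_of_real (exp ((- t\<^sup>2 / 2) / (a * real n powr (1 - 2 / real r)))) =
          complex_of_real (exp (- t\<^sup>2 / (2 * (real n * (c n)\<^sup>2 * a))))) sequentially"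
        by (intro eventually_sequentiallyI[of 1]) (simp only: nc divide_divide_eq_left)
      ultimately show ?thesis by (simp add: Lim_transform_eventually)
    qed
    have "weak_conv_m M (Z_law r (ereal lam))"
    proof (rule levy_continuity[OF M real_distribution_Z_law[OF r lam]])
      fix t
      have "(\<lambda>n. char (M n) t * complex_of_real (exp (- t\<^sup>2 / (2 * (real n * (c n)\<^sup>2 * a)))) /
          complex_of_real (exp (- t\<^sup>2 / (2 * (real n * (c n)\<^sup>2 * a))))) \<longlonglongrightarrow> char (Z_law r (ereal lam)) t / 1"
        by (intro tendsto_divide lim_prod fac) simp
      then show "(\<lambda>n. char (M n) t) \<longlonglongrightarrow> char (Z_law r (ereal lam)) t" by simp
    qed
    then show ?thesis using False by (simp add: tilde_lambda_eq)
  qed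
  then show ?thesis unfolding M_def r_def .
qed

end
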